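(* Assume A1–A5 (stated in the context), put $s=\frac{r}{2-4r}$ and, for $P_0>0$, $$\bar{\mathbb{B}}^s_{2\infty}(P_0)=\Bigl\{f=\sum_{j=1}^\infty\theta_j\phi_j:\ \theta_j\in\mathbb{R},\ \sup_{\lambda>0}\lambda^{2s}\sum_{j>\lambda}\theta_j^2\le P_0\Bigr\}.$$ Then for any $\varepsilon>0$ and any consistent sequence of alternatives $f_n$ with $cn^{-r}\le\|f_n\|\le Cn^{-r}$, $0<c<C<\infty$, there are $P_0>0$, constants $0<c_1<C_1<\infty$ and a sequence of functions $f_{1n}\in\bar{\mathbb{B}}^s_{2\infty}(P_0)$ with $c_1n^{-r}\le\|f_{1n}\|\le C_1n^{-r}$ such that: (1) $f_{1n}$ is orthogonal to $f_n-f_{1n}$; (2) for any $\alpha$, $0<\alpha<1$, for the tests $K_n$ generated by $T_n$ with $\alpha(K_n)=\alpha(1+o(1))$ as $n\to\infty$, there is $n_\varepsilon$ such that for any $n>n_\varepsilon$ $$|\beta(K_n,f_n)-\beta(K_n,f_{1n})|\le\varepsilon\qquad\text{and}\qquad \beta(K_n,f_n-f_{1n})\ge1-\alpha-\varepsilon .$$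
   Context: Setting. Fix $0<r<1/2$ and $\sigma>0$. One observes $dY_n(t)=f(t)\,dt+\frac{\sigma}{\sqrt n}\,dw(t)$, $t\in[0,1]$, with unknown signal $f\in L_2(0,1)$ and Gaussian white noise $dw$. Let $(\phi_j)_{j\ge1}$ be an orthonormal basis of $L_2(0,1)$; then $y_j=\int_0^1\phi_j\,dY_n=\theta_j+\frac{\sigma}{\sqrt n}\xi_j$ with $\theta_j=\int_0^1f\phi_j\,dt$ and $\xi_j$ i.i.d. standard Gaussian. The hypothesis is $f=0$; alternatives are $f=f_n$. The test statistics are $$T_n=\sum_{j=1}^\infty\kappa_{nj}^2y_j^2-\sigma^2n^{-1}\rho_n,\qquad \rho_n=\sum_{j=1}^\infty\kappa_{nj}^2 .$$ Assumptions on the coefficients. $[\cdot]$ is the integer part; $a_n\asymp b_n$ means that $a_n/b_n$ is bounded between two positive constants. A1: for each $n$ the sequence $\kappa_{nj}^2$, $j\ge1$, is decreasing. A2: there are positive constants $C_1,C_2$ such that $C_1<A_n=\sigma^{-4}n^2\sum_{j=1}^\infty\kappa_{nj}^4<C_2$ for each $n$. A3: there are positive constants $c_1,c_2$ such that $c_1n^{-2r}\le\rho_n\le c_2n^{-2r}$. Put $k_n=\sup\{k:\sum_{j<k}\kappa_{nj}^2\le\frac12\rho_n\}$ and $\kappa_n^2=\kappa_{nk_n}^2$. A4: there are $C_1$ and $\lambda>1$ such that $\kappa^2_{n,[(1+\delta)k_n]}<C_1(1+\delta)^{-\lambda}\kappa_n^2$ for any $\delta>0$ and each $n$. A5: $\kappa_{n1}^2\asymp\kappa_n^2$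 as $n\to\infty$, and for any $c>1$ there is $C>0$ such that $\kappa_{n,[ck_n]}^2\ge C\kappa_n^2$ for all $n$. Tests. A test $K_n$ generated by $T_n$ rejects the hypothesis when $T_n$ exceeds a threshold; $\alpha(K_n)$ is its type I error probability and $\beta(K_n,f)$ its type II error probability at $f$. A sequence $f_n$ is consistent if for any $\alpha\in(0,1)$, for tests $K_n$ generated by $T_n$ with $\alpha(K_n)=\alpha(1+o(1))$, one has $\limsup_{n\to\infty}\beta(K_n,f_n)<1-\alpha$. *)

theory Defs
  imports "HOL-Probability.Probability" "HOL-Library.Landau_Symbols"
begin

section \<open>The Hilbert space of square integrable functions on (0,1)\<close>

definition L2 :: "(real \<Rightarrow> real) set" where
  "L2 = {f. f \<in> borel_measurable (lebesgue_on {0<..<1}) \<and>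
            integrable (lebesgue_on {0<..<1}) (\<lambda>t. (f t)\<^sup>2)}"

definition L2_inner :: "(real \<Rightarrow> real) \<Rightarrow> (real \<Rightarrow> real) \<Rightarrow> real" where
  "L2_inner f g = (LINT t|lebesgue_on {0<..<1}. f t * g t)"

definition L2_norm :: "(real \<Rightarrow> real) \<Rightarrow> real" where
  "L2_norm f = sqrt (L2_inner f f)"

text \<open>Bases are indexed by the positive integers; the value at index 0 is irrelevant.\<close>

definition L2_expansion :: "(nat \<Rightarrow> real \<Rightarrow> real) \<Rightarrow> (real \<Rightarrow> real) \<Rightarrow> (nat \<Rightarrow> real) \<Rightarrow> bool" where
  "L2_expansion \<phi> f \<theta> \<longleftrightarrow>
     (\<lambda>N. L2_norm (\<lambda>t. f t - (\<Sum>j = 1..N. \<theta> j * \<phi> j t))) \<longlonglongrightarrow> 0"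

definition orthonormal_basis :: "(nat \<Rightarrow> real \<Rightarrow> real) \<Rightarrow> bool" where
  "orthonormal_basis \<phi> \<longleftrightarrow>
     (\<forall>j\<ge>1. \<phi> j \<in> L2) \<and>
     (\<forall>i\<ge>1. \<forall>j\<ge>1. L2_inner (\<phi> i) (\<phi> j) = (if i = j then 1 else 0)) \<and>
     (\<forall>f\<in>L2. L2_expansion \<phi> f (\<lambda>j. L2_inner f (\<phi> j)))"

text \<open>
  The body of functions with \<open>sup {l powr (2 * s) * (\<Sum>j>l. (\<theta> j)\<^sup>2) | l > 0} \<le> P0\<close>.
  The tail sums are finite because an L2-convergent orthonormal expansion has square
  summable coefficients.
\<close>

definition besov_body :: "(nat \<Rightarrow> real \<Rightarrow> real) \<Rightarrow> real \<Rightarrow> real \<Rightarrow> (real \<Rightarrow> real) set" where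
  "besov_body \<phi> s P0 = {f \<in> L2. \<exists>\<theta>. L2_expansion \<phi> f \<theta> \<and>
     (\<forall>l>0. l powr (2 * s) * (\<Sum>\<^sub>\<infinity>j\<in>{j. real j > l}. (\<theta> j)\<^sup>2) \<le> P0)}"


section \<open>Observations and quadratic tests\<close>

text \<open>
  The white noise enters through its coefficients \<open>\<xi> j = \<integral> \<phi> j dw\<close>, \<open>j \<ge> 1\<close>, which are
  independent standard Gaussian variables on a probability space \<open>M\<close>.
\<close>

definition iid_std_gaussian :: "'w measure \<Rightarrow> (nat \<Rightarrow> 'w \<Rightarrow> real) \<Rightarrow> bool" where
  "iid_std_gaussian M \<xi> \<longleftrightarrow>
     prob_space M \<and>
     prob_space.indep_vars M (\<lambda>_. borel) \<xi> {1..} \<and>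
     (\<forall>j\<ge>1. distributed M lborel (\<xi> j) std_normal_density)"

definition observation ::
  "(nat \<Rightarrow> 'w \<Rightarrow> real) \<Rightarrow> (nat \<Rightarrow> real \<Rightarrow> real) \<Rightarrow> real \<Rightarrow> nat \<Rightarrow> (real \<Rightarrow> real) \<Rightarrow> 'w \<Rightarrow> nat \<Rightarrow> real" where
  "observation \<xi> \<phi> \<sigma> n f \<omega> j = L2_inner f (\<phi> j) + \<sigma> / sqrt (real n) * \<xi> j \<omega>"

definition rho :: "(nat \<Rightarrow> nat \<Rightarrow> real) \<Rightarrow> nat \<Rightarrow> real" where
  "rho \<kappa> n = (\<Sum>\<^sub>\<infinity>j\<in>{1..}. (\<kappa> n j)\<^sup>2)"

definition test_stat :: "(nat \<Rightarrow> nat \<Rightarrow> real) \<Rightarrow> real \<Rightarrow> nat \<Rightarrow> (nat \<Rightarrow> real) \<Rightarrow> real" where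
  "test_stat \<kappa> \<sigma> n y =
     (\<Sum>\<^sub>\<infinity>j\<in>{1..}. (\<kappa> n j)\<^sup>2 * (y j)\<^sup>2) - \<sigma>\<^sup>2 / real n * rho \<kappa> n"

definition rejects :: "(nat \<Rightarrow> nat \<Rightarrow> real) \<Rightarrow> real \<Rightarrow> nat \<Rightarrow> real \<Rightarrow> (nat \<Rightarrow> real) \<Rightarrow> bool" where
  "rejects \<kappa> \<sigma> n x y \<longleftrightarrow> test_stat \<kappa> \<sigma> n y > x"

definition type_I_error ::
  "'w measure \<Rightarrow> (nat \<Rightarrow> 'w \<Rightarrow> real) \<Rightarrow> (nat \<Rightarrow> real \<Rightarrow> real) \<Rightarrow> real \<Rightarrow> (nat \<Rightarrow> nat \<Rightarrow> real)
     \<Rightarrow> nat \<Rightarrow> real \<Rightarrow> real" where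
  "type_I_error M \<xi> \<phi> \<sigma> \<kappa> n x =
     measure M {\<omega> \<in> space M. rejects \<kappa> \<sigma> n x (observation \<xi> \<phi> \<sigma> n (\<lambda>_. 0) \<omega>)}"

definition type_II_error ::
  "'w measure \<Rightarrow> (nat \<Rightarrow> 'w \<Rightarrow> real) \<Rightarrow> (nat \<Rightarrow> real \<Rightarrow> real) \<Rightarrow> real \<Rightarrow> (nat \<Rightarrow> nat \<Rightarrow> real)
     \<Rightarrow> nat \<Rightarrow> real \<Rightarrow> (real \<Rightarrow> real) \<Rightarrow> real" where
  "type_II_error M \<xi> \<phi> \<sigma> \<kappa> n x f =
     measure M {\<omega> \<in> space M. \<not> rejects \<kappa> \<sigma> n x (observation \<xi> \<phi> \<sigma> n f \<omega>)}"

text \<open>The thresholds \<open>x n\<close> give tests with type I error probabilities \<open>\<alpha> (1 + o(1))\<close>.\<close>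

definition asymptotic_level ::
  "'w measure \<Rightarrow> (nat \<Rightarrow> 'w \<Rightarrow> real) \<Rightarrow> (nat \<Rightarrow> real \<Rightarrow> real) \<Rightarrow> real \<Rightarrow> (nat \<Rightarrow> nat \<Rightarrow> real)
     \<Rightarrow> real \<Rightarrow> (nat \<Rightarrow> real) \<Rightarrow> bool" where
  "asymptotic_level M \<xi> \<phi> \<sigma> \<kappa> \<alpha> x \<longleftrightarrow>
     (\<lambda>n. type_I_error M \<xi> \<phi> \<sigma> \<kappa> n (x n)) \<sim>[sequentially] (\<lambda>_. \<alpha>)"

definition consistent ::
  "'w measure \<Rightarrow> (nat \<Rightarrow> 'w \<Rightarrow> real) \<Rightarrow> (nat \<Rightarrow> real \<Rightarrow> real) \<Rightarrow> real \<Rightarrow> (nat \<Rightarrow> nat \<Rightarrow> real)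
     \<Rightarrow> (nat \<Rightarrow> real \<Rightarrow> real) \<Rightarrow> bool" where
  "consistent M \<xi> \<phi> \<sigma> \<kappa> f \<longleftrightarrow>
     (\<forall>\<alpha> x. 0 < \<alpha> \<and> \<alpha> < 1 \<and> asymptotic_level M \<xi> \<phi> \<sigma> \<kappa> \<alpha> x \<longrightarrow>
        limsup (\<lambda>n. ereal (type_II_error M \<xi> \<phi> \<sigma> \<kappa> n (x n) (f n))) < ereal (1 - \<alpha>))"


section \<open>Assumptions on the coefficients\<close>

text \<open>
  Only \<open>n \<ge> 1\<close> and \<open>j \<ge> 1\<close> are meaningful. The lower bounds in \<open>A2\<close> and \<open>A3\<close> are positive,
  so they entail the convergence of the series (\<open>infsum\<close> of a divergent series is 0).
\<close>

definition A1 :: "(nat \<Rightarrow> nat \<Rightarrow> real) \<Rightarrow> bool" where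
  "A1 \<kappa> \<longleftrightarrow> (\<forall>n\<ge>1. antimono_on {1..} (\<lambda>j. (\<kappa> n j)\<^sup>2))"

definition A2 :: "real \<Rightarrow> (nat \<Rightarrow> nat \<Rightarrow> real) \<Rightarrow> bool" where
  "A2 \<sigma> \<kappa> \<longleftrightarrow> (\<exists>C1>0. \<exists>C2>0. \<forall>n\<ge>1.
     C1 < (real n)\<^sup>2 / \<sigma> ^ 4 * (\<Sum>\<^sub>\<infinity>j\<in>{1..}. (\<kappa> n j) ^ 4) \<and>
     (real n)\<^sup>2 / \<sigma> ^ 4 * (\<Sum>\<^sub>\<infinity>j\<in>{1..}. (\<kappa> n j) ^ 4) < C2)"

definition A3 :: "real \<Rightarrow> (nat \<Rightarrow> nat \<Rightarrow> real) \<Rightarrow> bool" where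
  "A3 r \<kappa> \<longleftrightarrow> (\<exists>c1>0. \<exists>c2>0. \<forall>n\<ge>1.
     c1 * real n powr (- 2 * r) \<le> rho \<kappa> n \<and> rho \<kappa> n \<le> c2 * real n powr (- 2 * r))"

definition k_index :: "(nat \<Rightarrow> nat \<Rightarrow> real) \<Rightarrow> nat \<Rightarrow> nat" where
  "k_index \<kappa> n = Sup {k. (\<Sum>j = 1..<k. (\<kappa> n j)\<^sup>2) \<le> rho \<kappa> n / 2}"

definition kappa_sq :: "(nat \<Rightarrow> nat \<Rightarrow> real) \<Rightarrow> nat \<Rightarrow> real" where
  "kappa_sq \<kappa> n = (\<kappa> n (k_index \<kappa> n))\<^sup>2"

definition A4 :: "(nat \<Rightarrow> nat \<Rightarrow> real) \<Rightarrow> bool" where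
  "A4 \<kappa> \<longleftrightarrow> (\<exists>C1. \<exists>l>1. \<forall>\<delta>>0. \<forall>n\<ge>1.
     (\<kappa> n (nat \<lfloor>(1 + \<delta>) * real (k_index \<kappa> n)\<rfloor>))\<^sup>2 < C1 * (1 + \<delta>) powr (- l) * kappa_sq \<kappa> n)"

definition A5 :: "(nat \<Rightarrow> nat \<Rightarrow> real) \<Rightarrow> bool" where
  "A5 \<kappa> \<longleftrightarrow>
     (\<lambda>n. (\<kappa> n 1)\<^sup>2) \<in> \<Theta>[sequentially](\<lambda>n. kappa_sq \<kappa> n) \<and>
     (\<forall>c>1. \<exists>C>0. \<forall>n\<ge>1.
        (\<kappa> n (nat \<lfloor>c * real (k_index \<kappa> n)\<rfloor>))\<^sup>2 \<ge> C * kappa_sq \<kappa> n)"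

end

theory Submission
  imports Defs
begin

text \<open>
  The approximation \<open>f1 n\<close> is the partial sum of the expansion of \<open>f n\<close> up to an index \<open>m n\<close> of
  order \<open>L * n powr (2 - 4 * r)\<close>, with \<open>L\<close> large depending on \<open>\<epsilon>\<close>. Orthogonality is then
  Pythagoras. Membership in a fixed body holds because the tail sums of \<open>f1 n\<close> vanish beyond
  \<open>m n\<close>, are at most \<open>(L2_norm (f n))\<^sup>2\<close>, which is of order \<open>n powr (- 2 * r)\<close>, and
  \<open>(m n) powr (2 * s)\<close> is of order \<open>n powr (2 * r)\<close> for this \<open>s\<close>.

  Everything else rests on one reduction. In terms of the coefficients \<open>\<theta>\<close> of a signal \<open>g\<close> the
  statistic is the statistic at \<open>0\<close>, plus the energy \<open>(\<Sum>j. (\<kappa> n j)\<^sup>2 * (\<theta> j)\<^sup>2)\<close>, plus a term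
  linear in the noise. For signals of norm \<open>O(n powr (- r))\<close> the energy is of order \<open>1 / n\<^sup>2\<close>, as
  is the standard deviation of the statistic at \<open>0\<close>, whereas the linear term is of smaller order,
  by a factor \<open>n powr (r - 1/2)\<close>. Hence the type II error at \<open>g\<close> is, uniformly in the threshold,
  close to the type II error at \<open>0\<close> with the threshold lowered by the energy (\<open>beta_shift\<close>), and
  the type II error at \<open>0\<close> moves little when the threshold moves by a small multiple of
  \<open>1 / n\<^sup>2\<close> (\<open>beta_zero_window\<close>). Type II errors are thus governed by energies alone.

  The second of these facts is an anticoncentration estimate for weighted sums of squares of
  Gaussian variables. Asymptotic normality would give it, but a direct argument suffices: the
  probability of a short interval is bounded by the expectation of a Gaussian kernel, which is an
  average of the characteristic function, and the latter is at most \<open>exp (- (t\<^sup>2 * S / 2))\<close> on a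
  range of \<open>t\<close> that is long when all weights are small (\<open>gaussian_kernel_bound\<close>,
  \<open>anticoncentration_weighted_squares\<close>). That the weights are small compared with \<open>1 / n\<close>
  follows from the assumptions on the coefficients (\<open>first_weight_bound\<close>).

  Three consequences finish the proof. Monotonicity of the weights gives
  \<open>(\<kappa> n m)\<^sup>2 \<le> rho \<kappa> n / m\<close>, so the energy of \<open>f n - f1 n\<close> is at most a small multiple of
  \<open>1 / n\<^sup>2\<close>; therefore \<open>f n\<close> and \<open>f1 n\<close>, as well as \<open>f n - f1 n\<close> and \<open>0\<close>, have nearly equal type
  II errors. Consistency forces the energy of \<open>f n\<close> to exceed a fixed multiple of \<open>1 / n\<^sup>2\<close>
  eventually (\<open>consistent_signal_energy\<close>), so \<open>f1 n\<close> retains a comparable energy, and since the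
  weights are \<open>O(n powr (2 * r - 2))\<close> this bounds its norm from below.
\<close>

section \<open>Truncated orthonormal expansions\<close>

lemma L2_D:
  assumes "f \<in> L2"
  shows L2_measurable: "f \<in> borel_measurable (lebesgue_on {0<..<1})"
    and L2_square_integrable: "integrable (lebesgue_on {0<..<1}) (\<lambda>t. (f t)\<^sup>2)"
  using assms by (auto simp: L2_def)

lemma L2_mult_integrable:
  assumes "f \<in> L2" "g \<in> L2"
  shows "integrable (lebesgue_on {0<..<1}) (\<lambda>t. f t * g t)"
proof (rule Bochner_Integration.integrable_bound)
  show "integrable (lebesgue_on {0<..<1}) (\<lambda>t. (f t)\<^sup>2 + (g t)\<^sup>2)"
    using assms by (intro Bochner_Integration.integrable_add L2_square_integrable)
  show "(\<lambda>t. f t * g t) \<in> borel_measurable (lebesgue_on {0<..<1})"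
    using assms by (intro borel_measurable_times L2_measurable)
  have "\<bar>f t * g t\<bar> \<le> (f t)\<^sup>2 + (g t)\<^sup>2" for t
    using sum_squares_bound[of "f t" "g t"] sum_squares_bound[of "f t" "- g t"]
    by (simp add: abs_le_iff)
  then show "AE t in lebesgue_on {0<..<1}. norm (f t * g t) \<le> norm ((f t)\<^sup>2 + (g t)\<^sup>2)"
    by (intro AE_I2) simp
qed

lemma L2_add:
  assumes "f \<in> L2" "g \<in> L2"
  shows "(\<lambda>t. f t + g t) \<in> L2"
proof -
  have "integrable (lebesgue_on {0<..<1}) (\<lambda>t. (f t)\<^sup>2 + (g t)\<^sup>2 + 2 * (f t * g t))"
    using assms
    by (intro Bochner_Integration.integrable_add integrable_mult_right L2_square_integrable
        L2_mult_integrable)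
  moreover have "(\<lambda>t. f t + g t) \<in> borel_measurable (lebesgue_on {0<..<1})"
    using assms by (intro borel_measurable_add L2_measurable)
  ultimately show ?thesis by (simp add: L2_def power2_sum mult.assoc)
qed

lemma L2_scale: "f \<in> L2 \<Longrightarrow> (\<lambda>t. a * f t) \<in> L2"
  by (auto simp: L2_def power_mult_distrib)

lemma L2_zero: "(\<lambda>t. 0) \<in> L2"
  by (simp add: L2_def)

lemma L2_diff:
  assumes "f \<in> L2" "g \<in> L2"
  shows "(\<lambda>t. f t - g t) \<in> L2"
  using L2_add[OF assms(1) L2_scale[OF assms(2), of "-1"]] by simp

lemma L2_sum:
  assumes "\<And>j. j \<in> A \<Longrightarrow> g j \<in> L2"
  shows "(\<lambda>t. \<Sum>j\<in>A. g j t) \<in> L2"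
  using assms
proof (induction A rule: infinite_finite_induct)
  case (insert j A)
  then show ?case by (simp add: L2_add)
qed (simp_all add: L2_zero)

lemma L2_inner_commute: "L2_inner f g = L2_inner g f"
  by (simp add: L2_inner_def mult.commute)

lemma L2_inner_scale_left: "L2_inner (\<lambda>t. a * f t) g = a * L2_inner f g"
  by (simp add: L2_inner_def mult.assoc)

lemma L2_inner_diff_left:
  assumes "f \<in> L2" "g \<in> L2" "h \<in> L2"
  shows "L2_inner (\<lambda>t. f t - g t) h = L2_inner f h - L2_inner g h"
  using assms by (simp add: L2_inner_def left_diff_distrib L2_mult_integrable)

lemma L2_inner_sum_left:
  assumes "\<And>j. j \<in> A \<Longrightarrow> g j \<in> L2" "h \<in> L2"
  shows "L2_inner (\<lambda>t. \<Sum>j\<in>A. g j t) h = (\<Sum>j\<in>A. L2_inner (g j) h)"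
  using assms
  by (simp add: L2_inner_def sum_distrib_right Bochner_Integration.integral_sum L2_mult_integrable)

lemma L2_norm_square: "(L2_norm f)\<^sup>2 = L2_inner f f"
  by (simp add: L2_norm_def L2_inner_def)

lemma L2_norm_nonneg: "0 \<le> L2_norm f"
  by (simp add: L2_norm_def L2_inner_def)

text \<open>
  Partial sums of the expansion in the basis; they are the orthogonal projections onto the spans
  of initial segments of the basis.
\<close>

definition L2_truncation :: "(nat \<Rightarrow> real \<Rightarrow> real) \<Rightarrow> (real \<Rightarrow> real) \<Rightarrow> nat \<Rightarrow> real \<Rightarrow> real" where
  "L2_truncation \<phi> f m = (\<lambda>t. \<Sum>j = 1..m. L2_inner f (\<phi> j) * \<phi> j t)"

context
  fixes \<phi> :: "nat \<Rightarrow> real \<Rightarrow> real"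
  assumes basis: "orthonormal_basis \<phi>"
begin

lemma basis_L2: "1 \<le> j \<Longrightarrow> \<phi> j \<in> L2"
  using basis by (simp add: orthonormal_basis_def)

lemma basis_inner: "1 \<le> i \<Longrightarrow> 1 \<le> j \<Longrightarrow> L2_inner (\<phi> i) (\<phi> j) = (if i = j then 1 else 0)"
  using basis by (simp add: orthonormal_basis_def)

lemma truncation_L2: "L2_truncation \<phi> f m \<in> L2"
  unfolding L2_truncation_def by (intro L2_sum L2_scale basis_L2) auto

lemma truncation_inner_left:
  assumes "h \<in> L2"
  shows "L2_inner (L2_truncation \<phi> f m) h = (\<Sum>j = 1..m. L2_inner f (\<phi> j) * L2_inner (\<phi> j) h)"
  unfolding L2_truncation_def
  by (subst L2_inner_sum_left) (auto intro!: L2_scale basis_L2 assms simp: L2_inner_scale_left)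

lemma truncation_coefficient:
  assumes "1 \<le> k"
  shows "L2_inner (L2_truncation \<phi> f m) (\<phi> k) = (if k \<le> m then L2_inner f (\<phi> k) else 0)"
proof -
  have "L2_inner (L2_truncation \<phi> f m) (\<phi> k)
      = (\<Sum>j = 1..m. L2_inner f (\<phi> j) * L2_inner (\<phi> j) (\<phi> k))"
    by (rule truncation_inner_left[OF basis_L2[OF assms]])
  also have "\<dots> = (\<Sum>j = 1..m. if j = k then L2_inner f (\<phi> j) else 0)"
    using assms by (intro sum.cong) (auto simp: basis_inner)
  also have "\<dots> = (if k \<le> m then L2_inner f (\<phi> k) else 0)"
    using assms by (subst sum.delta) auto
  finally show ?thesis .
qed

lemma truncation_norm_square: "(L2_norm (L2_truncation \<phi> f m))\<^sup>2 = (\<Sum>j = 1..m. (L2_inner f (\<phi> j))\<^sup>2)"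
proof -
  have "L2_inner (L2_truncation \<phi> f m) (L2_truncation \<phi> f m)
      = (\<Sum>j = 1..m. L2_inner f (\<phi> j) * L2_inner (L2_truncation \<phi> f m) (\<phi> j))"
    by (subst truncation_inner_left) (auto simp: truncation_L2 L2_inner_commute)
  then show ?thesis
    unfolding L2_norm_square
    by (simp add: truncation_coefficient power2_eq_square)
qed

lemma truncation_inner_right:
  assumes "f \<in> L2"
  shows "L2_inner f (L2_truncation \<phi> f m) = (L2_norm (L2_truncation \<phi> f m))\<^sup>2"
  unfolding truncation_norm_square
  using truncation_inner_left[OF assms, of f m]
  by (simp add: L2_inner_commute[of _ f] power2_eq_square)

lemma truncation_orthogonal:
  assumes "f \<in> L2"
  shows "L2_inner (L2_truncation \<phi> f m) (\<lambda>t. f t - L2_truncation \<phi> f m t) = 0"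
  using assms truncation_inner_right[OF assms, of m]
  by (subst L2_inner_commute)
     (simp add: L2_inner_diff_left truncation_L2 L2_norm_square)

lemma truncation_pythagoras:
  assumes "f \<in> L2"
  shows "(L2_norm f)\<^sup>2 = (L2_norm (L2_truncation \<phi> f m))\<^sup>2
    + (L2_norm (\<lambda>t. f t - L2_truncation \<phi> f m t))\<^sup>2"
proof -
  let ?p = "L2_truncation \<phi> f m"
  let ?r = "\<lambda>t. f t - ?p t"
  have r: "?r \<in> L2" by (intro L2_diff assms truncation_L2)
  have "L2_inner ?r ?r = L2_inner f ?r - L2_inner ?p ?r"
    by (rule L2_inner_diff_left[OF assms truncation_L2 r])
  also have "L2_inner f ?r = L2_inner f f - L2_inner ?p f"
    by (subst L2_inner_commute) (rule L2_inner_diff_left[OF assms truncation_L2 assms])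
  finally show ?thesis
    using truncation_orthogonal[OF assms, of m] truncation_inner_right[OF assms, of m]
      L2_inner_commute[of f ?p]
    unfolding L2_norm_square by linarith
qed

lemma truncation_norm_le: "f \<in> L2 \<Longrightarrow> L2_norm (L2_truncation \<phi> f m) \<le> L2_norm f"
  by (rule power2_le_imp_le[OF _ L2_norm_nonneg]) (use truncation_pythagoras[of f m] in simp)

lemma residual_norm_le: "f \<in> L2 \<Longrightarrow> L2_norm (\<lambda>t. f t - L2_truncation \<phi> f m t) \<le> L2_norm f"
  by (rule power2_le_imp_le[OF _ L2_norm_nonneg]) (use truncation_pythagoras[of f m] in simp)

lemma truncation_norm_tendsto:
  assumes "f \<in> L2"
  shows "(\<lambda>m. L2_norm (L2_truncation \<phi> f m)) \<longlonglongrightarrow> L2_norm f"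
proof -
  have "L2_expansion \<phi> f (\<lambda>j. L2_inner f (\<phi> j))"
    using basis assms by (simp add: orthonormal_basis_def)
  then have "(\<lambda>m. L2_norm (\<lambda>t. f t - L2_truncation \<phi> f m t)) \<longlonglongrightarrow> 0"
    by (simp add: L2_expansion_def L2_truncation_def)
  then have "(\<lambda>m. sqrt ((L2_norm f)\<^sup>2 - (L2_norm (\<lambda>t. f t - L2_truncation \<phi> f m t))\<^sup>2))
      \<longlonglongrightarrow> sqrt ((L2_norm f)\<^sup>2 - 0\<^sup>2)"
    by (intro tendsto_intros)
  moreover have "sqrt ((L2_norm f)\<^sup>2 - (L2_norm (\<lambda>t. f t - L2_truncation \<phi> f m t))\<^sup>2)
      = L2_norm (L2_truncation \<phi> f m)" for m
    using truncation_pythagoras[OF assms, of m] by (simp add: L2_norm_nonneg)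
  ultimately show ?thesis by (simp add: L2_norm_nonneg)
qed

lemma coefficient_sum_le: "f \<in> L2 \<Longrightarrow> (\<Sum>j = 1..m. (L2_inner f (\<phi> j))\<^sup>2) \<le> (L2_norm f)\<^sup>2"
  unfolding truncation_norm_square[symmetric] using truncation_pythagoras[of f m] by simp

lemma
  assumes "f \<in> L2"
  shows coefficients_square_summable: "(\<lambda>j. (L2_inner f (\<phi> j))\<^sup>2) summable_on {1..}"
    and bessel_inequality: "(\<Sum>\<^sub>\<infinity>j\<in>{1..}. (L2_inner f (\<phi> j))\<^sup>2) \<le> (L2_norm f)\<^sup>2"
proof -
  have bound: "sum (\<lambda>j. (L2_inner f (\<phi> j))\<^sup>2) F \<le> (L2_norm f)\<^sup>2" if "finite F" "F \<subseteq> {1..}" for F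
  proof -
    have "sum (\<lambda>j. (L2_inner f (\<phi> j))\<^sup>2) F \<le> (\<Sum>j = 1..Max (insert 0 F). (L2_inner f (\<phi> j))\<^sup>2)"
      using that by (intro sum_mono2) auto
    also have "\<dots> \<le> (L2_norm f)\<^sup>2"
      by (rule coefficient_sum_le[OF assms])
    finally show ?thesis .
  qed
  show *: "(\<lambda>j. (L2_inner f (\<phi> j))\<^sup>2) summable_on {1..}"
    by (rule nonneg_bdd_above_summable_on) (auto intro!: bdd_aboveI2[where M="(L2_norm f)\<^sup>2"] bound)
  show "(\<Sum>\<^sub>\<infinity>j\<in>{1..}. (L2_inner f (\<phi> j))\<^sup>2) \<le> (L2_norm f)\<^sup>2"
    by (rule infsum_le_finite_sums[OF *]) (use bound in auto)
qed

text \<open>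
  The supremum over \<open>l\<close> in the definition of the body is controlled at \<open>l = m\<close>, since the
  coefficients vanish beyond \<open>m\<close> and \<open>l powr (2 * s)\<close> is increasing.
\<close>

lemma truncation_in_besov_body:
  assumes "f \<in> L2" "0 \<le> s" "real m powr (2 * s) * (L2_norm f)\<^sup>2 \<le> P0"
  shows "L2_truncation \<phi> f m \<in> besov_body \<phi> s P0"
proof -
  define \<theta> where "\<theta> j = (if 1 \<le> j \<and> j \<le> m then L2_inner f (\<phi> j) else 0)" for j
  have expansion: "L2_expansion \<phi> (L2_truncation \<phi> f m) \<theta>"
    unfolding L2_expansion_def
  proof (rule tendsto_eventually, rule eventually_sequentiallyI)
    fix N assume "m \<le> N"
    then have "(\<Sum>j = 1..N. \<theta> j * \<phi> j t) = L2_truncation \<phi> f m t" for t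
      unfolding L2_truncation_def \<theta>_def by (intro sum.mono_neutral_cong_right) auto
    then show "L2_norm (\<lambda>t. L2_truncation \<phi> f m t - (\<Sum>j = 1..N. \<theta> j * \<phi> j t)) = 0"
      by (simp add: L2_norm_def L2_inner_def)
  qed
  have "l powr (2 * s) * (\<Sum>\<^sub>\<infinity>j\<in>{j. real j > l}. (\<theta> j)\<^sup>2) \<le> P0" if l: "0 < l" for l :: real
  proof (cases "l < real m")
    case True
    have "(\<Sum>\<^sub>\<infinity>j\<in>{j. real j > l}. (\<theta> j)\<^sup>2) = (\<Sum>\<^sub>\<infinity>j\<in>{j. real j > l \<and> j \<le> m}. (\<theta> j)\<^sup>2)"
      using l by (intro infsum_cong_neutral) (auto simp: \<theta>_def)
    also have "\<dots> = (\<Sum>j\<in>{j. real j > l \<and> j \<le> m}. (\<theta> j)\<^sup>2)"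
      by (rule infsum_finite) (rule finite_subset[of _ "{..m}"], auto)
    also have "\<dots> \<le> (\<Sum>j = 1..m. (L2_inner f (\<phi> j))\<^sup>2)"
      unfolding \<theta>_def using l by (intro sum_le_included[where i="\<lambda>j. j"]) (auto simp: Suc_le_eq)
    also have "\<dots> \<le> (L2_norm f)\<^sup>2"
      by (rule coefficient_sum_le[OF assms(1)])
    finally have "(\<Sum>\<^sub>\<infinity>j\<in>{j. real j > l}. (\<theta> j)\<^sup>2) \<le> (L2_norm f)\<^sup>2" .
    moreover have "l powr (2 * s) \<le> real m powr (2 * s)"
      using True l assms(2) by (intro powr_mono2) auto
    ultimately have "l powr (2 * s) * (\<Sum>\<^sub>\<infinity>j\<in>{j. real j > l}. (\<theta> j)\<^sup>2)
        \<le> real m powr (2 * s) * (L2_norm f)\<^sup>2"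
      by (intro mult_mono infsum_nonneg) auto
    then show ?thesis using assms(3) by simp
  next
    case False
    then have "(\<Sum>\<^sub>\<infinity>j\<in>{j. real j > l}. (\<theta> j)\<^sup>2) = 0"
      by (intro infsum_0) (auto simp: \<theta>_def)
    moreover have "0 \<le> P0"
      by (rule order_trans[OF _ assms(3)]) simp
    ultimately show ?thesis by simp
  qed
  then show ?thesis
    unfolding besov_body_def using truncation_L2 expansion by auto
qed

end

section \<open>Gaussian kernels and characteristic functions\<close>

lemma integral_std_normal_exp_neg_square:
  fixes h :: real
  assumes "0 \<le> h"
  shows "(LINT z|std_normal_distribution. exp (- (h * z\<^sup>2 / 2))) = 1 / sqrt (1 + h)"
proof -
  have pos: "0 < 1 / sqrt (1 + h)" using assms by simp
  have eq: "std_normal_density z * exp (- (h * z\<^sup>2 / 2))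
      = 1 / sqrt (1 + h) * normal_density 0 (1 / sqrt (1 + h)) z" for z
    using assms
    by (simp add: normal_density_def exp_add [symmetric] power_divide real_sqrt_divide
        real_sqrt_mult) (simp add: field_simps)
  have "(LINT z|std_normal_distribution. exp (- (h * z\<^sup>2 / 2)))
      = (LINT z|lborel. std_normal_density z * exp (- (h * z\<^sup>2 / 2)))"
    by (subst integral_density) auto
  also have "\<dots> = 1 / sqrt (1 + h)"
    by (simp only: eq integral_mult_right_zero integral_normal_density[OF pos] mult_1_right)
  finally show ?thesis .
qed

text \<open>
  The function \<open>exp (- (u\<^sup>2 / 2))\<close> is the characteristic function of the standard Gaussian law,
  so the kernel at \<open>(y - x) / d\<close> is the average of \<open>iexp (z * (y - x) / d)\<close> over a standard Gaussian \<open>z\<close>.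
  Exchanging the two integrals produces the characteristic function of \<open>M\<close>.
\<close>

lemma (in real_distribution) gaussian_kernel_le_integral_char:
  assumes "0 < d"
  shows "(LINT y|M. exp (- (((y - x) / d)\<^sup>2 / 2)))
    \<le> (LINT z|std_normal_distribution. cmod (char M (z / d)))"
proof -
  let ?N = std_normal_distribution
  interpret N: real_distribution ?N by (rule real_dist_normal_dist)
  interpret P: pair_sigma_finite M ?N ..
  interpret PP: pair_prob_space M ?N ..
  have int: "integrable (M \<Otimes>\<^sub>M ?N) (\<lambda>(y, z). iexp ((y - x) / d * z))"
    by (intro PP.integrable_const_bound[where B=1]) (auto simp: split_beta')
  have "complex_of_real (LINT y|M. exp (- (((y - x) / d)\<^sup>2 / 2)))
      = (CLINT y|M. char ?N ((y - x) / d))"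
    by (simp add: char_std_normal_distribution)
  also have "\<dots> = (CLINT y|M. CLINT z|?N. iexp ((y - x) / d * z))"
    by (simp add: char_def)
  also have "\<dots> = (CLINT z|?N. CLINT y|M. iexp ((y - x) / d * z))"
    using P.Fubini_integral[OF int] by simp
  also have "\<dots> = (CLINT z|?N. iexp (- (x / d * z)) * char M (z / d))"
  proof (rule Bochner_Integration.integral_cong[OF refl])
    fix z
    have "iexp ((y - x) / d * z) = iexp (- (x / d * z)) * iexp (z / d * y)" for y
      by (simp add: exp_add [symmetric] field_simps diff_divide_distrib)
    then show "(CLINT y|M. iexp ((y - x) / d * z)) = iexp (- (x / d * z)) * char M (z / d)"
      by (simp only: char_def integral_mult_right_zero)
  qed
  finally have eq: "complex_of_real (LINT y|M. exp (- (((y - x) / d)\<^sup>2 / 2)))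
      = (CLINT z|?N. iexp (- (x / d * z)) * char M (z / d))" .
  have "(LINT y|M. exp (- (((y - x) / d)\<^sup>2 / 2)))
      \<le> cmod (complex_of_real (LINT y|M. exp (- (((y - x) / d)\<^sup>2 / 2))))"
    by (simp only: norm_of_real abs_ge_self)
  also have "\<dots> = cmod (CLINT z|?N. iexp (- (x / d * z)) * char M (z / d))"
    by (simp only: eq)
  also have "\<dots> \<le> (LINT z|?N. cmod (iexp (- (x / d * z)) * char M (z / d)))"
    by (rule integral_norm_bound)
  finally show ?thesis by (simp add: norm_mult)
qed

text \<open>
  Only frequencies \<open>z / d\<close> of absolute value up to \<open>T\<close> are under control. The remaining ones
  contribute at most the probability that a standard Gaussian exceeds \<open>T * d\<close>, estimated by
  Chebyshev; the others contribute a Gaussian integral of order \<open>d / sqrt S\<close>.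
\<close>

lemma (in real_distribution) gaussian_kernel_bound:
  assumes "0 < d" "0 < S" "0 < T"
    and char: "\<And>t. \<bar>t\<bar> \<le> T \<Longrightarrow> cmod (char M t) \<le> exp (- (t\<^sup>2 * S / 2))"
  shows "(LINT y|M. exp (- (((y - x) / d)\<^sup>2 / 2))) \<le> d / sqrt S + 1 / (T * d)\<^sup>2"
proof -
  let ?N = std_normal_distribution
  interpret N: real_distribution ?N by (rule real_dist_normal_dist)
  have m2: "(LINT z|?N. z\<^sup>2) = 1"
    using std_normal_distribution_even_moments(1)[of 1] by (simp add: fact_numeral)
  have i2: "integrable ?N (\<lambda>z. z\<^sup>2)" by (rule integrable_std_normal_distribution_moment)
  have ie: "integrable ?N (\<lambda>z. exp (- (S / d\<^sup>2 * z\<^sup>2 / 2)))"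
    using assms by (intro N.integrable_const_bound[where B=1]) auto
  have "(LINT y|M. exp (- (((y - x) / d)\<^sup>2 / 2))) \<le> (LINT z|?N. cmod (char M (z / d)))"
    by (rule gaussian_kernel_le_integral_char) fact
  also have "\<dots> \<le> (LINT z|?N. exp (- (S / d\<^sup>2 * z\<^sup>2 / 2)) + 1 / (T * d)\<^sup>2 * z\<^sup>2)"
  proof (rule integral_mono)
    show "integrable ?N (\<lambda>z. cmod (char M (z / d)))"
      by (intro N.integrable_const_bound[where B=1]) (auto simp: cmod_char_le_1)
    show "integrable ?N (\<lambda>z. exp (- (S / d\<^sup>2 * z\<^sup>2 / 2)) + 1 / (T * d)\<^sup>2 * z\<^sup>2)"
      using i2 ie by simp
    fix z :: real
    show "cmod (char M (z / d)) \<le> exp (- (S / d\<^sup>2 * z\<^sup>2 / 2)) + 1 / (T * d)\<^sup>2 * z\<^sup>2"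
    proof (cases "\<bar>z / d\<bar> \<le> T")
      case True
      have "cmod (char M (z / d)) \<le> exp (- (S / d\<^sup>2 * z\<^sup>2 / 2))"
        using char[OF True] by (simp add: power_divide mult.commute)
      then show ?thesis by (smt (verit) divide_nonneg_nonneg mult_nonneg_nonneg zero_le_power2)
    next
      case False
      then have "T * d \<le> \<bar>z\<bar>" using \<open>0 < d\<close> by (simp add: field_simps)
      then have "(T * d)\<^sup>2 \<le> z\<^sup>2"
        using assms by (metis abs_of_pos mult_pos_pos abs_le_square_iff)
      \<comment> \<open>here the trivial bound 1 on the characteristic function is dominated by the Chebyshev term\<close>
      then have "1 \<le> 1 / (T * d)\<^sup>2 * z\<^sup>2" using assms by (simp add: field_simps)
      then show ?thesis using cmod_char_le_1[of "z / d"] by (smt (verit) exp_ge_zero)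
    qed
  qed
  also have "\<dots> = 1 / sqrt (1 + S / d\<^sup>2) + 1 / (T * d)\<^sup>2"
    using i2 ie m2 assms integral_std_normal_exp_neg_square[of "S / d\<^sup>2"]
    by simp
  also have "1 / sqrt (1 + S / d\<^sup>2) \<le> 1 / sqrt (S / d\<^sup>2)"
    using assms by (intro divide_left_mono mult_pos_pos) (auto intro!: add_pos_pos)
  also have "1 / sqrt (S / d\<^sup>2) = d / sqrt S"
    using assms by (simp add: real_sqrt_divide)
  finally show ?thesis by simp
qed

text \<open>
  The centred square of a standard Gaussian variable has variance 2, so near 0 its characteristic
  function is \<open>1 - u\<^sup>2\<close> up to an error of third order, governed by the third absolute moment. Giving
  up half of the quadratic term absorbs the error.
\<close>

lemma (in prob_space) char_centered_square_gaussian: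
  obtains u0 :: real where "0 < u0"
    "\<And>X u. distributed M lborel X std_normal_density \<Longrightarrow> \<bar>u\<bar> \<le> u0 \<Longrightarrow>
       cmod (char (distr M borel (\<lambda>\<omega>. (X \<omega>)\<^sup>2 - 1)) u) \<le> exp (- (u\<^sup>2 / 2))"
proof -
  let ?N = std_normal_distribution
  define B where "B = (LINT z|?N. \<bar>z\<^sup>2 - 1\<bar> ^ 3)"
  \<comment> \<open>chosen so that the third order error is at most a sixth of the quadratic term\<close>
  define u0 where "u0 = 1 / (1 + \<bar>B\<bar>)"
  have u0: "0 < u0" "u0 \<le> 1" "u0 * B \<le> 1"
    by (auto simp: u0_def field_simps abs_le_iff)
  show thesis
  proof (rule that[OF u0(1)])
    fix X u assume X: "distributed M lborel X std_normal_density" and u: "\<bar>u\<bar> \<le> u0"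
    have Xm[measurable]: "X \<in> borel_measurable M" using X by (simp add: distributed_def)
    have dist: "distr M borel X = ?N"
      using X by (simp add: distributed_def cong: distr_cong)
    have tr: "integrable M (\<lambda>\<omega>. g (X \<omega>)) \<longleftrightarrow> integrable ?N g"
        "(LINT \<omega>|M. g (X \<omega>)) = (LINT z|?N. g z)"
      if [measurable]: "g \<in> borel_measurable borel" for g :: "real \<Rightarrow> real"
      by (simp_all add: dist[symmetric] integrable_distr_eq integral_distr)
    have mom: "integrable M (\<lambda>\<omega>. X \<omega> ^ k)" for k
      using tr(1)[of "\<lambda>z. z ^ k"] integrable_std_normal_distribution_moment[of k] by simp
    interpret N: real_distribution ?N by (rule real_dist_normal_dist)
    have E2: "expectation (\<lambda>\<omega>. (X \<omega>)\<^sup>2) = 1"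
      using tr(2)[of "\<lambda>z. z\<^sup>2"] std_normal_distribution_even_moments(1)[of 1] by (simp add: fact_numeral)
    have E4: "expectation (\<lambda>\<omega>. (X \<omega>) ^ 4) = 3"
      using tr(2)[of "\<lambda>z. z ^ 4"] std_normal_distribution_even_moments(1)[of 2] by (simp add: fact_numeral)
    have sq: "((X \<omega>)\<^sup>2 - 1)\<^sup>2 = X \<omega> ^ 4 - 2 * (X \<omega>)\<^sup>2 + 1" for \<omega>
      by (simp add: power2_eq_square power4_eq_xxxx algebra_simps)
    have E0: "expectation (\<lambda>\<omega>. (X \<omega>)\<^sup>2 - 1) = 0"
      using E2 mom[of 2] by (simp add: prob_space)
    have V: "expectation (\<lambda>\<omega>. ((X \<omega>)\<^sup>2 - 1)\<^sup>2) = 2"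
      unfolding sq using E2 E4 mom[of 2] mom[of 4] by (simp add: prob_space)
    have i3: "integrable M (\<lambda>\<omega>. \<bar>(X \<omega>)\<^sup>2 - 1\<bar> ^ 3)"
    proof -
      have "integrable M (\<lambda>\<omega>. X \<omega> ^ 6 - 3 * X \<omega> ^ 4 + 3 * X \<omega> ^ 2 - 1)"
        using mom by simp
      also have "(\<lambda>\<omega>. X \<omega> ^ 6 - 3 * X \<omega> ^ 4 + 3 * X \<omega> ^ 2 - 1) = (\<lambda>\<omega>. ((X \<omega>)\<^sup>2 - 1) ^ 3)"
        by (intro ext) (simp add: power2_eq_square power3_eq_cube eval_nat_numeral algebra_simps)
      finally have "integrable M (\<lambda>\<omega>. \<bar>((X \<omega>)\<^sup>2 - 1) ^ 3\<bar>)" by (rule integrable_abs)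
      then show ?thesis by (simp add: power_abs)
    qed
    let ?c = "char (distr M borel (\<lambda>\<omega>. (X \<omega>)\<^sup>2 - 1)) u"
    have "cmod (?c - (1 - u\<^sup>2 * 2 / 2))
      \<le> (u\<^sup>2 / 6) * expectation (\<lambda>\<omega>. min (6 * ((X \<omega>)\<^sup>2 - 1)\<^sup>2) (\<bar>u\<bar> * \<bar>(X \<omega>)\<^sup>2 - 1\<bar> ^ 3))"
    proof (rule char_approx3'[OF _ _ _ _ _ refl])
      show "integrable M (\<lambda>\<omega>. (X \<omega>)\<^sup>2 - 1)" using mom by simp
      show "integrable M (\<lambda>\<omega>. ((X \<omega>)\<^sup>2 - 1)\<^sup>2)" unfolding sq using mom by simp
    qed (use E0 V in auto)
    also have "\<dots> \<le> (u\<^sup>2 / 6) * expectation (\<lambda>\<omega>. \<bar>u\<bar> * \<bar>(X \<omega>)\<^sup>2 - 1\<bar> ^ 3)"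
      using i3 by (intro mult_left_mono integral_mono') auto
    also have "\<dots> = (u\<^sup>2 / 6) * (\<bar>u\<bar> * B)"
      by (simp add: B_def tr(2)[of "\<lambda>z. \<bar>z\<^sup>2 - 1\<bar> ^ 3"])
    also have "\<dots> \<le> (u\<^sup>2 / 6) * 1"
    proof (intro mult_left_mono)
      have "0 \<le> B" by (simp add: B_def)
      then have "\<bar>u\<bar> * B \<le> u0 * B" using u by (intro mult_right_mono)
      then show "\<bar>u\<bar> * B \<le> 1" using u0 by simp
    qed auto
    also have "\<dots> \<le> u\<^sup>2 / 2" by simp
    finally have "cmod (?c - complex_of_real (1 - u\<^sup>2)) \<le> u\<^sup>2 / 2" by simp
    then have near: "cmod (?c - complex_of_real (1 - u\<^sup>2)) \<le> u\<^sup>2 / 2" .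
    have "\<bar>u\<bar> \<le> 1" using u u0(2) by linarith
    then have "u\<^sup>2 \<le> 1" by (simp only: abs_square_le_1)
    then have one: "cmod (complex_of_real (1 - u\<^sup>2)) = 1 - u\<^sup>2"
      by (simp only: norm_of_real abs_of_nonneg diff_ge_0_iff_ge)
    have "cmod ?c \<le> 1 - u\<^sup>2 / 2"
      using norm_triangle_sub[of ?c "complex_of_real (1 - u\<^sup>2)"] near one by linarith
    also have "\<dots> \<le> exp (- (u\<^sup>2 / 2))" using exp_ge_add_one_self[of "- (u\<^sup>2 / 2)"] by simp
    finally show "cmod ?c \<le> exp (- (u\<^sup>2 / 2))" .
  qed
qed

section \<open>Quadratic forms in a Gaussian sequence\<close>

text \<open>
  The second identity also covers divergent series, where both sides are 0; it makes sums over
  \<open>{1..}\<close> of nonnegative random variables measurable.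
\<close>

lemma
  fixes f :: "nat \<Rightarrow> real"
  assumes "\<And>j. 1 \<le> j \<Longrightarrow> 0 \<le> f j"
  shows summable_on_from_1_iff: "f summable_on {1..} \<longleftrightarrow> summable (\<lambda>j. f (Suc j))"
    and infsum_from_1_eq: "infsum f {1..} = enn2real (\<Sum>j. ennreal (f (Suc j)))"
proof -
  have im: "{1..} = Suc ` UNIV" by (auto simp: image_iff Suc_le_eq gr0_conv_Suc)
  have *: "f summable_on {1..} \<longleftrightarrow> (\<lambda>j. f (Suc j)) summable_on UNIV"
    unfolding im by (subst summable_on_reindex) (auto simp: o_def)
  then show 1: "f summable_on {1..} \<longleftrightarrow> summable (\<lambda>j. f (Suc j))"
    using assms by (simp add: summable_on_UNIV_nonneg_real_iff)
  have 2: "infsum f {1..} = (\<Sum>\<^sub>\<infinity>j. f (Suc j))"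
    unfolding im by (subst infsum_reindex) (auto simp: o_def)
  show "infsum f {1..} = enn2real (\<Sum>j. ennreal (f (Suc j)))"
  proof (cases "summable (\<lambda>j. f (Suc j))")
    case True
    then have "(\<lambda>j. f (Suc j)) sums (\<Sum>\<^sub>\<infinity>j. f (Suc j))"
      using 1 * by (intro has_sum_imp_sums has_sum_infsum) simp
    then have "(\<Sum>\<^sub>\<infinity>j. f (Suc j)) = suminf (\<lambda>j. f (Suc j))" by (rule sums_unique)
    moreover have "0 \<le> suminf (\<lambda>j. f (Suc j))" using True assms by (intro suminf_nonneg) auto
    moreover have "(\<Sum>j. ennreal (f (Suc j))) = ennreal (suminf (\<lambda>j. f (Suc j)))"
      using assms True by (intro suminf_ennreal2) auto
    ultimately show ?thesis by (simp only: 2 enn2real_ennreal)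
  next
    case False
    have "0 \<le> f (Suc j)" for j using assms by simp
    with False have "(\<Sum>j. ennreal (f (Suc j))) = top"
      using summable_suminf_not_top[of "\<lambda>j. f (Suc j)"] by blast
    moreover have "infsum f {1..} = 0" by (rule infsum_not_exists) (use False 1 in blast)
    ultimately show ?thesis by (simp only: enn2real_top)
  qed
qed

lemma partial_sums_tendsto_infsum_from_1:
  fixes f :: "nat \<Rightarrow> real"
  assumes "f summable_on {1..}"
  shows "(\<lambda>N. \<Sum>j = 1..N. f j) \<longlonglongrightarrow> infsum f {1..}"
proof -
  have im: "{1..} = Suc ` UNIV" by (auto simp: image_iff Suc_le_eq gr0_conv_Suc)
  have "(f has_sum infsum f {1..}) (Suc ` UNIV)" using assms im by simp
  then have "((\<lambda>j. f (Suc j)) has_sum infsum f {1..}) UNIV"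
    by (subst (asm) has_sum_reindex) (auto simp: o_def)
  then have "(\<lambda>j. f (Suc j)) sums infsum f {1..}" by (rule has_sum_imp_sums)
  then show ?thesis
    by (simp add: sums_def sum.shift_bounds_Suc_ivl[symmetric] lessThan_atLeast0
        sum.atLeast1_atMost_eq)
qed

locale gaussian_sequence = prob_space M for M :: "'w measure" +
  fixes \<xi> :: "nat \<Rightarrow> 'w \<Rightarrow> real"
  assumes indep: "indep_vars (\<lambda>_. borel) \<xi> {1..}"
    and gauss: "1 \<le> j \<Longrightarrow> distributed M lborel (\<xi> j) std_normal_density"
begin

lemma measurable_noise [measurable]: "1 \<le> j \<Longrightarrow> \<xi> j \<in> borel_measurable M"
  using gauss[of j] by (simp add: distributed_def)

lemma measurable_noise_Suc [measurable]: "\<xi> (Suc j) \<in> borel_measurable M"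
  by simp

lemma noise_moment:
  assumes "1 \<le> j"
  shows "integrable M (\<lambda>\<omega>. \<xi> j \<omega> ^ k)"
    and "expectation (\<lambda>\<omega>. \<xi> j \<omega> ^ k) = (LINT z|std_normal_distribution. z ^ k)"
proof -
  have dist: "distr M borel (\<xi> j) = std_normal_distribution"
    using gauss[OF assms] by (simp add: distributed_def cong: distr_cong)
  show "integrable M (\<lambda>\<omega>. \<xi> j \<omega> ^ k)"
    using integrable_std_normal_distribution_moment[of k] assms
    by (simp add: dist[symmetric] integrable_distr_eq)
  show "expectation (\<lambda>\<omega>. \<xi> j \<omega> ^ k) = (LINT z|std_normal_distribution. z ^ k)"
    using assms by (simp add: dist[symmetric] integral_distr)
qed

lemma noise_expectation: "1 \<le> j \<Longrightarrow> expectation (\<xi> j) = 0"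
  using noise_moment(2)[of j 1] integral_std_normal_distribution_moment_odd[of 1] by simp

lemma noise_expectation_square: "1 \<le> j \<Longrightarrow> expectation (\<lambda>\<omega>. (\<xi> j \<omega>)\<^sup>2) = 1"
  using noise_moment(2)[of j 2] std_normal_distribution_even_moments[of 1]
  by (simp add: numeral_2_eq_2)

lemma noise_orthonormal:
  assumes "1 \<le> i" "1 \<le> j"
  shows "integrable M (\<lambda>\<omega>. \<xi> i \<omega> * \<xi> j \<omega>)"
    and "expectation (\<lambda>\<omega>. \<xi> i \<omega> * \<xi> j \<omega>) = (if i = j then 1 else 0)"
proof -
  have int: "integrable M (\<xi> k)" if "1 \<le> k" for k
    using noise_moment(1)[OF that, of 1] by simp
  have "integrable M (\<lambda>\<omega>. \<xi> i \<omega> * \<xi> j \<omega>) \<and>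
      expectation (\<lambda>\<omega>. \<xi> i \<omega> * \<xi> j \<omega>) = (if i = j then 1 else 0)"
  proof (cases "i = j")
    case True
    then show ?thesis
      using noise_moment(1)[of j 2] noise_expectation_square[of j] assms
      by (simp add: power2_eq_square)
  next
    case False
    have ind: "indep_vars (\<lambda>_. borel) \<xi> {i, j}"
      by (rule indep_vars_subset[OF indep]) (use assms in auto)
    show ?thesis
      using indep_vars_lebesgue_integral[OF _ ind] indep_vars_integrable[OF _ ind] False
        noise_expectation assms int by auto
  qed
  then show "integrable M (\<lambda>\<omega>. \<xi> i \<omega> * \<xi> j \<omega>)"
    "expectation (\<lambda>\<omega>. \<xi> i \<omega> * \<xi> j \<omega>) = (if i = j then 1 else 0)" by auto
qed

lemma noise_linear_second_moment:
  fixes a :: "nat \<Rightarrow> real"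
  shows "integrable M (\<lambda>\<omega>. (\<Sum>j = 1..N. a j * \<xi> j \<omega>)\<^sup>2)"
    and "expectation (\<lambda>\<omega>. (\<Sum>j = 1..N. a j * \<xi> j \<omega>)\<^sup>2) = (\<Sum>j = 1..N. (a j)\<^sup>2)"
proof -
  have eq: "(\<Sum>j = 1..N. a j * \<xi> j \<omega>)\<^sup>2
      = (\<Sum>i = 1..N. \<Sum>j = 1..N. (a i * a j) * (\<xi> i \<omega> * \<xi> j \<omega>))" for \<omega>
    unfolding power2_eq_square sum_product by (simp add: ac_simps)
  show "integrable M (\<lambda>\<omega>. (\<Sum>j = 1..N. a j * \<xi> j \<omega>)\<^sup>2)"
    unfolding eq by (intro Bochner_Integration.integrable_sum integrable_mult_right noise_orthonormal) auto
  have "expectation (\<lambda>\<omega>. (\<Sum>j = 1..N. a j * \<xi> j \<omega>)\<^sup>2)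
      = (\<Sum>i = 1..N. \<Sum>j = 1..N. expectation (\<lambda>\<omega>. (a i * a j) * (\<xi> i \<omega> * \<xi> j \<omega>)))"
  proof -
    have int: "integrable M (\<lambda>\<omega>. (a i * a j) * (\<xi> i \<omega> * \<xi> j \<omega>))"
      if "i \<in> {1..N}" "j \<in> {1..N}" for i j
      using that by (intro integrable_mult_right noise_orthonormal) auto
    have "expectation (\<lambda>\<omega>. \<Sum>i = 1..N. \<Sum>j = 1..N. (a i * a j) * (\<xi> i \<omega> * \<xi> j \<omega>))
        = (\<Sum>i = 1..N. expectation (\<lambda>\<omega>. \<Sum>j = 1..N. (a i * a j) * (\<xi> i \<omega> * \<xi> j \<omega>)))"
      by (intro Bochner_Integration.integral_sum Bochner_Integration.integrable_sum int)
    also have "\<dots>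
        = (\<Sum>i = 1..N. \<Sum>j = 1..N. expectation (\<lambda>\<omega>. (a i * a j) * (\<xi> i \<omega> * \<xi> j \<omega>)))"
      by (intro sum.cong refl Bochner_Integration.integral_sum int)
    finally show ?thesis by (simp only: eq)
  qed
  also have "\<dots> = (\<Sum>i = 1..N. \<Sum>j = 1..N. if i = j then (a i)\<^sup>2 else 0)"
    by (intro sum.cong refl) (auto simp: noise_orthonormal power2_eq_square)
  also have "\<dots> = (\<Sum>j = 1..N. (a j)\<^sup>2)" by simp
  finally show "expectation (\<lambda>\<omega>. (\<Sum>j = 1..N. a j * \<xi> j \<omega>)\<^sup>2) = (\<Sum>j = 1..N. (a j)\<^sup>2)" .
qed

lemma AE_summable_weighted_squares:
  fixes w :: "nat \<Rightarrow> real"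
  assumes "\<And>j. 0 \<le> w j" "w summable_on {1..}"
  shows "AE \<omega> in M. (\<lambda>j. w j * (\<xi> j \<omega>)\<^sup>2) summable_on {1..}"
proof -
  have sm: "summable (\<lambda>j. w (Suc j))" using assms summable_on_from_1_iff[of w] by simp
  have "(\<integral>\<^sup>+\<omega>. (\<Sum>j. ennreal (w (Suc j) * (\<xi> (Suc j) \<omega>)\<^sup>2)) \<partial>M)
      = (\<Sum>j. \<integral>\<^sup>+\<omega>. ennreal (w (Suc j) * (\<xi> (Suc j) \<omega>)\<^sup>2) \<partial>M)"
    by (rule nn_integral_suminf) measurable
  also have "\<dots> = (\<Sum>j. ennreal (w (Suc j)))"
    using noise_moment(1)[of _ 2] noise_expectation_square assms
    by (subst nn_integral_eq_integral) auto
  also have "\<dots> \<noteq> \<infinity>" using sm assms by (simp add: suminf_ennreal2)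
  finally have "AE \<omega> in M. (\<Sum>j. ennreal (w (Suc j) * (\<xi> (Suc j) \<omega>)\<^sup>2)) \<noteq> \<infinity>"
    by (intro nn_integral_PInf_AE) auto
  then show ?thesis
  proof eventually_elim
    case (elim \<omega>)
    then show ?case
      using assms(1) by (subst summable_on_from_1_iff) (auto intro!: summable_suminf_not_top)
  qed
qed

lemma quadratic_form_measurable:
  fixes w \<theta> :: "nat \<Rightarrow> real"
  assumes "\<And>j. 0 \<le> w j"
  shows "(\<lambda>\<omega>. \<Sum>\<^sub>\<infinity>j\<in>{1..}. w j * (\<theta> j + \<tau> * \<xi> j \<omega>)\<^sup>2) \<in> borel_measurable M"
  using assms by (subst infsum_from_1_eq) auto

text \<open>
  For the partial sums, independence multiplies the bounds \<open>exp (- (u\<^sup>2 / 2))\<close> on the factors of the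
  characteristic function, valid for \<open>\<bar>t\<bar> \<le> u0 / b\<close> because each weight is at most \<open>b\<close>. The kernel
  expectation, unlike the probability of an interval, passes to the infinite sum by dominated
  convergence.
\<close>

lemma anticoncentration_weighted_squares:
  "\<exists>K>0. \<forall>w b d y. (\<forall>j. 0 \<le> w j) \<and> (\<forall>j\<ge>1. w j \<le> b) \<and> 0 < b \<and> w summable_on {1..} \<and>
       (\<lambda>j. (w j)\<^sup>2) summable_on {1..} \<and> 0 < (\<Sum>\<^sub>\<infinity>j\<in>{1..}. (w j)\<^sup>2) \<and> 0 < d \<longrightarrow>
       prob {\<omega> \<in> space M. \<bar>(\<Sum>\<^sub>\<infinity>j\<in>{1..}. w j * (\<xi> j \<omega>)\<^sup>2) - y\<bar> \<le> d}
         \<le> 2 * (d / sqrt (\<Sum>\<^sub>\<infinity>j\<in>{1..}. (w j)\<^sup>2) + K * (b / d)\<^sup>2)"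
proof -
  obtain u0 :: real where u0: "0 < u0"
    "\<And>X u. distributed M lborel X std_normal_density \<Longrightarrow> \<bar>u\<bar> \<le> u0 \<Longrightarrow>
       cmod (char (distr M borel (\<lambda>\<omega>. (X \<omega>)\<^sup>2 - 1)) u) \<le> exp (- (u\<^sup>2 / 2))"
    using char_centered_square_gaussian by blast
  show ?thesis
  proof (intro exI[of _ "1 / u0\<^sup>2"] conjI allI impI, goal_cases)
    case 1
    show "0 < 1 / u0\<^sup>2" using u0 by simp
  next
    case (2 w b d y)
    then have w0: "\<And>j. 0 \<le> w j" and wb: "\<And>j. 1 \<le> j \<Longrightarrow> w j \<le> b" and b: "0 < b"
      and sw: "w summable_on {1..}" and sw2: "(\<lambda>j. (w j)\<^sup>2) summable_on {1..}"
      and S: "0 < (\<Sum>\<^sub>\<infinity>j\<in>{1..}. (w j)\<^sup>2)" and d: "0 < d" by blast+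
    define Y where "Y N \<omega> = (\<Sum>j = 1..N. w j * (\<xi> j \<omega>)\<^sup>2)" for N \<omega>
    define Z where "Z \<omega> = (\<Sum>\<^sub>\<infinity>j\<in>{1..}. w j * (\<xi> j \<omega>)\<^sup>2)" for \<omega>
    define S where "S N = (\<Sum>j = 1..N. (w j)\<^sup>2)" for N
    define S' where "S' = (\<Sum>\<^sub>\<infinity>j\<in>{1..}. (w j)\<^sup>2)"
    define G where "G v = exp (- (((v - y) / d)\<^sup>2 / 2))" for v :: real
    have [measurable]: "Y N \<in> borel_measurable M" for N
      unfolding Y_def by (intro borel_measurable_sum) auto
    have Zm[measurable]: "Z \<in> borel_measurable M"
      using quadratic_form_measurable[of w "\<lambda>_. 0" 1] w0 by (simp add: Z_def[abs_def])
    have [measurable]: "G \<in> borel_measurable borel" unfolding G_def by measurable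
    have G1: "0 \<le> G v" "G v \<le> 1" for v by (auto simp: G_def)
    have S_lim: "S \<longlonglongrightarrow> S'"
      unfolding S_def S'_def by (rule partial_sums_tendsto_infsum_from_1) fact
    have S': "0 < S'" using S by (simp add: S'_def)
    have finite_bound: "expectation (\<lambda>\<omega>. G (Y N \<omega>)) \<le> d / sqrt (S N) + 1 / (u0 / b * d)\<^sup>2"
      if SN: "0 < S N" for N
    proof -
      define X where "X j \<omega> = w j * ((\<xi> j \<omega>)\<^sup>2 - 1)" for j \<omega>
      let ?D = "distr M borel (\<lambda>\<omega>. \<Sum>j\<in>{1..N}. X j \<omega>)"
      have Xm: "X j \<in> borel_measurable M" if "1 \<le> j" for j
        unfolding X_def using that by measurable
      have Xs[measurable]: "(\<lambda>\<omega>. \<Sum>j\<in>{1..N}. X j \<omega>) \<in> borel_measurable M"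
        by (intro borel_measurable_sum Xm) auto
      interpret D: real_distribution ?D by (rule real_distribution_distr[OF Xs])
      have ind: "indep_vars (\<lambda>_. borel) X {1..N}"
        unfolding X_def
        by (rule indep_vars_compose2[OF indep_vars_subset[OF indep]]) auto
      have char1: "cmod (char (distr M borel (X j)) t) \<le> exp (- (t\<^sup>2 * (w j)\<^sup>2 / 2))"
        if j: "1 \<le> j" and t: "\<bar>t\<bar> \<le> u0 / b" for j t
      proof -
        have [measurable]: "\<xi> j \<in> borel_measurable M" using j by simp
        have "\<bar>t * w j\<bar> \<le> u0 / b * b"
          unfolding abs_mult using t wb[OF j] w0[of j] u0 b by (intro mult_mono) auto
        then have *: "\<bar>t * w j\<bar> \<le> u0" using b by simp
        have "char (distr M borel (X j)) t
            = char (distr M borel (\<lambda>\<omega>. (\<xi> j \<omega>)\<^sup>2 - 1)) (t * w j)"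
          using Xm[OF j] by (simp add: char_def integral_distr X_def mult.assoc)
        then show ?thesis using u0(2)[OF gauss[OF j] *] by (simp add: power_mult_distrib)
      qed
      have char: "cmod (char ?D t) \<le> exp (- (t\<^sup>2 * S N / 2))" if t: "\<bar>t\<bar> \<le> u0 / b" for t
      proof -
        have "cmod (char ?D t) = (\<Prod>j = 1..N. cmod (char (distr M borel (X j)) t))"
          by (simp only: char_distr_sum[OF ind] prod_norm)
        also have "\<dots> \<le> (\<Prod>j = 1..N. exp (- (t\<^sup>2 * (w j)\<^sup>2 / 2)))"
          using char1 t by (intro prod_mono) auto
        also have "\<dots> = exp (- (t\<^sup>2 * S N / 2))"
          by (simp add: exp_sum[symmetric] S_def sum_negf sum_distrib_left sum_divide_distrib)
        finally show ?thesis .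
      qed
      \<comment> \<open>the centring of the squares is undone by moving the centre of the kernel\<close>
      have "(LINT v|?D. exp (- (((v - (y - (\<Sum>j = 1..N. w j))) / d)\<^sup>2 / 2)))
          \<le> d / sqrt (S N) + 1 / (u0 / b * d)\<^sup>2"
        using u0 b d SN char by (intro D.gaussian_kernel_bound) auto
      also have "(LINT v|?D. exp (- (((v - (y - (\<Sum>j = 1..N. w j))) / d)\<^sup>2 / 2)))
          = expectation (\<lambda>\<omega>. G (Y N \<omega>))"
        by (subst integral_distr)
          (auto simp: G_def X_def Y_def sum_subtractf right_diff_distrib algebra_simps)
      finally show ?thesis .
    qed
    have "(\<lambda>N. expectation (\<lambda>\<omega>. G (Y N \<omega>))) \<longlonglongrightarrow> expectation (\<lambda>\<omega>. G (Z \<omega>))"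
    proof (rule integral_dominated_convergence[where w="\<lambda>_. 1"])
      show "AE \<omega> in M. (\<lambda>N. G (Y N \<omega>)) \<longlonglongrightarrow> G (Z \<omega>)"
        using AE_summable_weighted_squares[of w, OF w0 sw]
      proof eventually_elim
        case (elim \<omega>)
        then have "(\<lambda>N. Y N \<omega>) \<longlonglongrightarrow> Z \<omega>"
          unfolding Y_def Z_def by (rule partial_sums_tendsto_infsum_from_1)
        then show ?case unfolding G_def using d by (intro tendsto_intros) auto
      qed
    qed (use G1 in auto)
    moreover have "(\<lambda>N. d / sqrt (S N) + 1 / (u0 / b * d)\<^sup>2)
        \<longlonglongrightarrow> d / sqrt S' + 1 / (u0 / b * d)\<^sup>2"
      using S' by (intro tendsto_intros S_lim) auto
    moreover have "eventually (\<lambda>N. 0 < S N) sequentially"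
      using order_tendstoD(1)[OF S_lim S'] .
    then have "eventually (\<lambda>N. expectation (\<lambda>\<omega>. G (Y N \<omega>))
        \<le> d / sqrt (S N) + 1 / (u0 / b * d)\<^sup>2) sequentially"
      by eventually_elim (rule finite_bound)
    ultimately have lim: "expectation (\<lambda>\<omega>. G (Z \<omega>)) \<le> d / sqrt S' + 1 / (u0 / b * d)\<^sup>2"
      by (intro tendsto_le[OF sequentially_bot]) auto
    have intG: "integrable M (\<lambda>\<omega>. G (Z \<omega>))"
      by (intro integrable_const_bound[where B=1]) (use G1 in auto)
    \<comment> \<open>inside the window the kernel is at least 1/2, and Markov applies\<close>
    have "prob {\<omega> \<in> space M. \<bar>Z \<omega> - y\<bar> \<le> d} \<le> prob {\<omega> \<in> space M. 1/2 \<le> G (Z \<omega>)}"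
    proof (rule finite_measure_mono)
      have "1/2 \<le> G v" if "\<bar>v - y\<bar> \<le> d" for v
      proof -
        have "\<bar>(v - y) / d\<bar> \<le> 1" using that d by simp
        then have "((v - y) / d)\<^sup>2 \<le> 1" by (simp only: abs_square_le_1)
        then show ?thesis
          unfolding G_def using exp_ge_add_one_self[of "- (((v - y) / d)\<^sup>2 / 2)"] by linarith
      qed
      then show "{\<omega> \<in> space M. \<bar>Z \<omega> - y\<bar> \<le> d} \<subseteq> {\<omega> \<in> space M. 1/2 \<le> G (Z \<omega>)}" by auto
    qed measurable
    also have "\<dots> \<le> expectation (\<lambda>\<omega>. G (Z \<omega>)) / (1/2)"
      by (rule integral_Markov_inequality_measure[OF intG, where A="{}"]) (use G1 in auto)
    also have "\<dots> \<le> 2 * (d / sqrt S' + 1 / (u0 / b * d)\<^sup>2)" using lim by simp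
    also have "1 / (u0 / b * d)\<^sup>2 = 1 / u0\<^sup>2 * (b / d)\<^sup>2"
      by (simp add: power_mult_distrib power_divide)
    finally show "prob {\<omega> \<in> space M. \<bar>(\<Sum>\<^sub>\<infinity>j\<in>{1..}. w j * (\<xi> j \<omega>)\<^sup>2) - y\<bar> \<le> d}
         \<le> 2 * (d / sqrt (\<Sum>\<^sub>\<infinity>j\<in>{1..}. (w j)\<^sup>2) + 1 / u0\<^sup>2 * (b / d)\<^sup>2)"
      by (simp add: Z_def S'_def)
  qed
qed

text \<open>
  Expanding the squares gives the pure noise form, the constant \<open>\<Sum>j. w j * (\<theta> j)\<^sup>2\<close>, and a cross
  term that is linear in the noise with variance at most \<open>4 * \<tau>\<^sup>2 * b\<^sup>2 * (\<Sum>j. (\<theta> j)\<^sup>2)\<close>. The cross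
  term changes the event only if it exceeds \<open>d\<close>, or if the noise form is within \<open>d\<close> of the shifted
  threshold; these are the two contributions to the error.
\<close>

lemma quadratic_form_shift:
  fixes w \<theta> :: "nat \<Rightarrow> real" and b d q x \<tau> :: real
  assumes w0: "\<And>j. 0 \<le> w j" and wb: "\<And>j. 1 \<le> j \<Longrightarrow> w j \<le> b" and sw: "w summable_on {1..}"
    and s\<theta>: "(\<lambda>j. (\<theta> j)\<^sup>2) summable_on {1..}" and "0 < d"
    and conc: "\<And>y. prob {\<omega> \<in> space M. \<bar>(\<Sum>\<^sub>\<infinity>j\<in>{1..}. w j * (\<tau> * \<xi> j \<omega>)\<^sup>2) - y\<bar> \<le> d} \<le> q"
  shows "\<bar>prob {\<omega> \<in> space M. (\<Sum>\<^sub>\<infinity>j\<in>{1..}. w j * (\<theta> j + \<tau> * \<xi> j \<omega>)\<^sup>2) \<le> x}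
      - prob {\<omega> \<in> space M. (\<Sum>\<^sub>\<infinity>j\<in>{1..}. w j * (\<tau> * \<xi> j \<omega>)\<^sup>2)
                \<le> x - (\<Sum>\<^sub>\<infinity>j\<in>{1..}. w j * (\<theta> j)\<^sup>2)}\<bar>
    \<le> 4 * \<tau>\<^sup>2 * b\<^sup>2 * (\<Sum>\<^sub>\<infinity>j\<in>{1..}. (\<theta> j)\<^sup>2) / d\<^sup>2 + q"
proof -
  define Q where "Q \<omega> = (\<Sum>\<^sub>\<infinity>j\<in>{1..}. w j * (\<theta> j + \<tau> * \<xi> j \<omega>)\<^sup>2)" for \<omega>
  define Q0 where "Q0 \<omega> = (\<Sum>\<^sub>\<infinity>j\<in>{1..}. w j * (\<tau> * \<xi> j \<omega>)\<^sup>2)" for \<omega>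
  define R where "R = (\<Sum>\<^sub>\<infinity>j\<in>{1..}. w j * (\<theta> j)\<^sup>2)"
  define \<Theta> where "\<Theta> = (\<Sum>\<^sub>\<infinity>j\<in>{1..}. (\<theta> j)\<^sup>2)"
  define D where "D \<omega> = Q \<omega> - Q0 \<omega> - R" for \<omega>
  define L where "L N \<omega> = (\<Sum>j = 1..N. (2 * \<tau> * w j * \<theta> j) * \<xi> j \<omega>)" for N \<omega>
  have Qm[measurable]: "Q \<in> borel_measurable M"
    using quadratic_form_measurable[of w \<theta> \<tau>] w0 by (simp add: Q_def[abs_def])
  have Q0m[measurable]: "Q0 \<in> borel_measurable M"
    using quadratic_form_measurable[of w "\<lambda>_. 0" \<tau>] w0 by (simp add: Q0_def[abs_def])
  have Dm[measurable]: "D \<in> borel_measurable M" unfolding D_def by measurable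
  have Lm[measurable]: "L N \<in> borel_measurable M" for N
    unfolding L_def by (intro borel_measurable_sum) auto
  have b0: "0 \<le> b" using w0[of 1] wb[of 1] by simp
  have \<Theta>0: "0 \<le> \<Theta>" unfolding \<Theta>_def by (rule infsum_nonneg) auto
  have sR: "(\<lambda>j. w j * (\<theta> j)\<^sup>2) summable_on {1..}"
  proof (rule summable_on_comparison_test[OF summable_on_cmult_right[OF s\<theta>, of b]])
  qed (use w0 wb in \<open>auto intro: mult_right_mono\<close>)
  have "AE \<omega> in M. (\<lambda>N. L N \<omega>) \<longlonglongrightarrow> D \<omega>"
    using AE_summable_weighted_squares[of w, OF w0 sw]
  proof eventually_elim
    case (elim \<omega>)
    have s0: "(\<lambda>j. w j * (\<tau> * \<xi> j \<omega>)\<^sup>2) summable_on {1..}"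
      using summable_on_cmult_right[OF elim, of "\<tau>\<^sup>2"]
      by (simp add: power_mult_distrib mult.left_commute)
    have s1: "(\<lambda>j. w j * (\<theta> j + \<tau> * \<xi> j \<omega>)\<^sup>2) summable_on {1..}"
    proof (rule summable_on_comparison_test)
      show "(\<lambda>j. 2 * (w j * (\<theta> j)\<^sup>2) + 2 * (w j * (\<tau> * \<xi> j \<omega>)\<^sup>2)) summable_on {1..}"
        by (intro summable_on_add summable_on_cmult_right sR s0)
      fix j
      have "(\<theta> j + \<tau> * \<xi> j \<omega>)\<^sup>2 \<le> 2 * (\<theta> j)\<^sup>2 + 2 * (\<tau> * \<xi> j \<omega>)\<^sup>2"
        using sum_squares_bound[of "\<theta> j" "\<tau> * \<xi> j \<omega>"] by (simp add: power2_sum)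
      from mult_left_mono[OF this w0[of j]]
      show "w j * (\<theta> j + \<tau> * \<xi> j \<omega>)\<^sup>2 \<le> 2 * (w j * (\<theta> j)\<^sup>2) + 2 * (w j * (\<tau> * \<xi> j \<omega>)\<^sup>2)"
        by (simp add: algebra_simps)
    qed (use w0 in auto)
    have "(\<lambda>N. (\<Sum>j = 1..N. w j * (\<theta> j + \<tau> * \<xi> j \<omega>)\<^sup>2) - (\<Sum>j = 1..N. w j * (\<tau> * \<xi> j \<omega>)\<^sup>2)
          - (\<Sum>j = 1..N. w j * (\<theta> j)\<^sup>2)) \<longlonglongrightarrow> D \<omega>"
      unfolding D_def Q_def Q0_def R_def
      by (intro tendsto_diff partial_sums_tendsto_infsum_from_1 s1 s0 sR)
    moreover have "(\<Sum>j = 1..N. w j * (\<theta> j + \<tau> * \<xi> j \<omega>)\<^sup>2) - (\<Sum>j = 1..N. w j * (\<tau> * \<xi> j \<omega>)\<^sup>2)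
          - (\<Sum>j = 1..N. w j * (\<theta> j)\<^sup>2) = L N \<omega>" for N
      unfolding L_def sum_subtractf[symmetric]
      by (intro sum.cong refl) (simp add: power2_eq_square algebra_simps)
    ultimately show ?case by simp
  qed
  \<comment> \<open>the second moment of the cross term is bounded by Fatou, along its partial sums\<close>
  then have AE_D: "AE \<omega> in M. ennreal ((D \<omega>)\<^sup>2) = liminf (\<lambda>N. ennreal ((L N \<omega>)\<^sup>2))"
  proof eventually_elim
    case (elim \<omega>)
    then have "(\<lambda>N. ennreal ((L N \<omega>)\<^sup>2)) \<longlonglongrightarrow> ennreal ((D \<omega>)\<^sup>2)"
      by (intro tendsto_ennrealI tendsto_power)
    then show ?case by (rule lim_imp_Liminf[OF sequentially_bot, symmetric])
  qed
  have L2: "(\<integral>\<^sup>+\<omega>. ennreal ((L N \<omega>)\<^sup>2) \<partial>M) \<le> ennreal (4 * \<tau>\<^sup>2 * b\<^sup>2 * \<Theta>)" for N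
  proof -
    have "(\<integral>\<^sup>+\<omega>. ennreal ((L N \<omega>)\<^sup>2) \<partial>M) = ennreal (\<Sum>j = 1..N. (2 * \<tau> * w j * \<theta> j)\<^sup>2)"
      unfolding L_def
      by (simp only: nn_integral_eq_integral[OF noise_linear_second_moment(1) AE_I2[OF zero_le_power2]]
          noise_linear_second_moment(2))
    also have "(\<Sum>j = 1..N. (2 * \<tau> * w j * \<theta> j)\<^sup>2) \<le> (\<Sum>j = 1..N. 4 * \<tau>\<^sup>2 * b\<^sup>2 * (\<theta> j)\<^sup>2)"
    proof (rule sum_mono)
      fix j assume "j \<in> {1..N}"
      then have "(w j)\<^sup>2 \<le> b\<^sup>2" using w0 wb by (intro power_mono) auto
      then have "4 * \<tau>\<^sup>2 * (\<theta> j)\<^sup>2 * (w j)\<^sup>2 \<le> 4 * \<tau>\<^sup>2 * (\<theta> j)\<^sup>2 * b\<^sup>2"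
        by (intro mult_left_mono) auto
      then show "(2 * \<tau> * w j * \<theta> j)\<^sup>2 \<le> 4 * \<tau>\<^sup>2 * b\<^sup>2 * (\<theta> j)\<^sup>2"
        by (simp add: power_mult_distrib mult_ac)
    qed
    also have "\<dots> = 4 * \<tau>\<^sup>2 * b\<^sup>2 * (\<Sum>j = 1..N. (\<theta> j)\<^sup>2)" by (simp add: sum_distrib_left)
    also have "\<dots> \<le> 4 * \<tau>\<^sup>2 * b\<^sup>2 * \<Theta>"
      unfolding \<Theta>_def by (intro mult_left_mono finite_sum_le_infsum s\<theta>) auto
    finally show ?thesis by (simp add: ennreal_leI)
  qed
  have D2: "(\<integral>\<^sup>+\<omega>. ennreal ((D \<omega>)\<^sup>2) \<partial>M) \<le> ennreal (4 * \<tau>\<^sup>2 * b\<^sup>2 * \<Theta>)"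
  proof -
    have "(\<integral>\<^sup>+\<omega>. ennreal ((D \<omega>)\<^sup>2) \<partial>M) = (\<integral>\<^sup>+\<omega>. liminf (\<lambda>N. ennreal ((L N \<omega>)\<^sup>2)) \<partial>M)"
      by (rule nn_integral_cong_AE) fact
    also have "\<dots> \<le> liminf (\<lambda>N. \<integral>\<^sup>+\<omega>. ennreal ((L N \<omega>)\<^sup>2) \<partial>M)"
      by (rule nn_integral_liminf) measurable
    also have "\<dots> \<le> liminf (\<lambda>N. ennreal (4 * \<tau>\<^sup>2 * b\<^sup>2 * \<Theta>))"
      by (rule Liminf_mono) (use L2 in auto)
    finally show ?thesis by (simp add: Liminf_const)
  qed
  have iD: "integrable M (\<lambda>\<omega>. (D \<omega>)\<^sup>2)"
    using D2 by (intro integrableI_nonneg) (auto intro: le_less_trans)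
  have ED: "expectation (\<lambda>\<omega>. (D \<omega>)\<^sup>2) \<le> 4 * \<tau>\<^sup>2 * b\<^sup>2 * \<Theta>"
    using D2 \<Theta>0 by (subst (asm) nn_integral_eq_integral[OF iD]) (auto simp: ennreal_le_iff)
  have far: "prob {\<omega> \<in> space M. d\<^sup>2 \<le> (D \<omega>)\<^sup>2} \<le> 4 * \<tau>\<^sup>2 * b\<^sup>2 * \<Theta> / d\<^sup>2"
  proof -
    have "prob {\<omega> \<in> space M. d\<^sup>2 \<le> (D \<omega>)\<^sup>2} \<le> expectation (\<lambda>\<omega>. (D \<omega>)\<^sup>2) / d\<^sup>2"
      by (rule integral_Markov_inequality_measure[OF iD, where A="{}"]) (use \<open>0 < d\<close> in auto)
    also have "\<dots> \<le> 4 * \<tau>\<^sup>2 * b\<^sup>2 * \<Theta> / d\<^sup>2" using ED by (intro divide_right_mono) auto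
    finally show ?thesis .
  qed
  have far_iff: "d\<^sup>2 \<le> (D \<omega>)\<^sup>2 \<longleftrightarrow> d \<le> \<bar>D \<omega>\<bar>" for \<omega>
    using \<open>0 < d\<close> abs_le_square_iff[of d "D \<omega>"] by simp
  let ?F = "{\<omega> \<in> space M. d\<^sup>2 \<le> (D \<omega>)\<^sup>2}" and ?C = "{\<omega> \<in> space M. \<bar>Q0 \<omega> - (x - R)\<bar> \<le> d}"
  let ?A = "{\<omega> \<in> space M. Q \<omega> \<le> x}" and ?B = "{\<omega> \<in> space M. Q0 \<omega> \<le> x - R}"
  have bad: "prob (?F \<union> ?C) \<le> 4 * \<tau>\<^sup>2 * b\<^sup>2 * \<Theta> / d\<^sup>2 + q"
  proof -
    have "prob (?F \<union> ?C) \<le> prob ?F + prob ?C" by (rule measure_Un_le) measurable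
    then show ?thesis using far conc[of "x - R"] by (simp add: Q0_def)
  qed
  have "prob ?A \<le> prob (?B \<union> (?F \<union> ?C))"
    by (rule finite_measure_mono) (auto simp: far_iff, auto simp: D_def)
  also have "\<dots> \<le> prob ?B + prob (?F \<union> ?C)" by (rule measure_Un_le) measurable
  finally have 1: "prob ?A \<le> prob ?B + prob (?F \<union> ?C)" .
  have "prob ?B \<le> prob (?A \<union> (?F \<union> ?C))"
    by (rule finite_measure_mono) (auto simp: far_iff, auto simp: D_def)
  also have "\<dots> \<le> prob ?A + prob (?F \<union> ?C)" by (rule measure_Un_le) measurable
  finally have 2: "prob ?B \<le> prob ?A + prob (?F \<union> ?C)" .
  have "\<bar>prob ?A - prob ?B\<bar> \<le> 4 * \<tau>\<^sup>2 * b\<^sup>2 * \<Theta> / d\<^sup>2 + q" using 1 2 bad by linarith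
  then show ?thesis by (simp only: Q_def Q0_def R_def \<Theta>_def)
qed

end

section \<open>Size of the weights\<close>

locale quadratic_weights =
  fixes \<kappa> :: "nat \<Rightarrow> nat \<Rightarrow> real" and r \<sigma> :: real
  assumes r_pos: "0 < r" and r_less: "r < 1/2" and \<sigma>_pos: "0 < \<sigma>"
    and A1: "A1 \<kappa>" and A2: "A2 \<sigma> \<kappa>" and A3: "A3 r \<kappa>" and A5: "A5 \<kappa>"
begin

lemma weights_antimono:
  assumes "1 \<le> n" "1 \<le> i" "i \<le> j"
  shows "(\<kappa> n j)\<^sup>2 \<le> (\<kappa> n i)\<^sup>2"
  using A1 assms unfolding A1_def by (auto simp: monotone_on_def)

lemma rho_pos: "1 \<le> n \<Longrightarrow> 0 < rho \<kappa> n"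
proof -
  assume n: "1 \<le> n"
  obtain c1 where "0 < c1" "c1 * real n powr (- 2 * r) \<le> rho \<kappa> n"
    using A3 n unfolding A3_def by blast
  moreover have "0 < real n powr (- 2 * r)" using n by simp
  ultimately show ?thesis by (metis less_le_trans mult_pos_pos)
qed

lemma weights_summable: "1 \<le> n \<Longrightarrow> (\<lambda>j. (\<kappa> n j)\<^sup>2) summable_on {1..}"
  using rho_pos[of n] infsum_not_exists[of "\<lambda>j. (\<kappa> n j)\<^sup>2" "{1..}"] unfolding rho_def by force

lemma squared_weights_summable:
  assumes "1 \<le> n"
  shows "(\<lambda>j. ((\<kappa> n j)\<^sup>2)\<^sup>2) summable_on {1..}"
proof -
  obtain C1 where "0 < C1" "C1 < (real n)\<^sup>2 / \<sigma> ^ 4 * (\<Sum>\<^sub>\<infinity>j\<in>{1..}. (\<kappa> n j) ^ 4)"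
    using A2 assms unfolding A2_def by blast
  then have "(\<Sum>\<^sub>\<infinity>j\<in>{1..}. (\<kappa> n j) ^ 4) \<noteq> 0" by auto
  then have "(\<lambda>j. (\<kappa> n j) ^ 4) summable_on {1..}" using infsum_not_exists by blast
  then show ?thesis by simp
qed

lemma squared_weights_bounds:
  obtains C1 C2 where "0 < C1" "0 < C2"
    "\<And>n. 1 \<le> n \<Longrightarrow> C1 * \<sigma> ^ 4 / (real n)\<^sup>2 \<le> (\<Sum>\<^sub>\<infinity>j\<in>{1..}. ((\<kappa> n j)\<^sup>2)\<^sup>2)"
    "\<And>n. 1 \<le> n \<Longrightarrow> (\<Sum>\<^sub>\<infinity>j\<in>{1..}. ((\<kappa> n j)\<^sup>2)\<^sup>2) \<le> C2 * \<sigma> ^ 4 / (real n)\<^sup>2"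
proof -
  obtain C1 C2 where C: "0 < C1" "0 < C2" "\<forall>n\<ge>1.
     C1 < (real n)\<^sup>2 / \<sigma> ^ 4 * (\<Sum>\<^sub>\<infinity>j\<in>{1..}. (\<kappa> n j) ^ 4) \<and>
     (real n)\<^sup>2 / \<sigma> ^ 4 * (\<Sum>\<^sub>\<infinity>j\<in>{1..}. (\<kappa> n j) ^ 4) < C2"
    using A2 unfolding A2_def by blast
  show thesis
  proof (rule that[of C1 C2])
    fix n :: nat assume n: "1 \<le> n"
    have p: "0 < (real n)\<^sup>2 / \<sigma> ^ 4" using n \<sigma>_pos by simp
    have eq: "(\<Sum>\<^sub>\<infinity>j\<in>{1..}. ((\<kappa> n j)\<^sup>2)\<^sup>2) = (\<Sum>\<^sub>\<infinity>j\<in>{1..}. (\<kappa> n j) ^ 4)" by simp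
    have c: "c * \<sigma> ^ 4 / (real n)\<^sup>2 = c / ((real n)\<^sup>2 / \<sigma> ^ 4)" for c by simp
    show "C1 * \<sigma> ^ 4 / (real n)\<^sup>2 \<le> (\<Sum>\<^sub>\<infinity>j\<in>{1..}. ((\<kappa> n j)\<^sup>2)\<^sup>2)"
      unfolding eq c pos_divide_le_eq[OF p] using C n by (simp add: mult.commute less_imp_le)
    show "(\<Sum>\<^sub>\<infinity>j\<in>{1..}. ((\<kappa> n j)\<^sup>2)\<^sup>2) \<le> C2 * \<sigma> ^ 4 / (real n)\<^sup>2"
      unfolding eq c pos_le_divide_eq[OF p] using C n by (simp add: mult.commute less_imp_le)
  qed (use C in auto)
qed

lemma weight_le_rho_div:
  assumes "1 \<le> n" "1 \<le> m"
  shows "real m * (\<kappa> n m)\<^sup>2 \<le> rho \<kappa> n"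
proof -
  have "real m * (\<kappa> n m)\<^sup>2 = (\<Sum>j = 1..m. (\<kappa> n m)\<^sup>2)" by simp
  also have "\<dots> \<le> (\<Sum>j = 1..m. (\<kappa> n j)\<^sup>2)"
    using assms by (intro sum_mono weights_antimono) auto
  also have "\<dots> \<le> rho \<kappa> n"
    unfolding rho_def using assms by (intro finite_sum_le_infsum weights_summable) auto
  finally show ?thesis .
qed

text \<open>
  The supremum defining \<open>k_index\<close> is attained: the partial sums converge to \<open>rho\<close>, which exceeds
  \<open>rho / 2\<close>, so the set of admissible indices is bounded. One step further the sum passes half of
  \<open>rho\<close>.
\<close>

lemma k_index_half:
  assumes "1 \<le> n"
  shows "1 \<le> k_index \<kappa> n" and "rho \<kappa> n / 2 \<le> (\<Sum>j = 1..k_index \<kappa> n. (\<kappa> n j)\<^sup>2)"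
proof -
  let ?S = "{k. (\<Sum>j = 1..<k. (\<kappa> n j)\<^sup>2) \<le> rho \<kappa> n / 2}"
  have "(\<lambda>N. \<Sum>j = 1..N. (\<kappa> n j)\<^sup>2) \<longlonglongrightarrow> rho \<kappa> n"
    unfolding rho_def by (rule partial_sums_tendsto_infsum_from_1[OF weights_summable[OF assms]])
  then have "eventually (\<lambda>N. rho \<kappa> n / 2 < (\<Sum>j = 1..N. (\<kappa> n j)\<^sup>2)) sequentially"
    using rho_pos[OF assms] by (intro order_tendstoD(1)) auto
  then obtain N where N: "rho \<kappa> n / 2 < (\<Sum>j = 1..N. (\<kappa> n j)\<^sup>2)"
    by (auto simp: eventually_sequentially)
  have "k \<le> N" if "k \<in> ?S" for k
  proof (rule ccontr)
    assume "\<not> k \<le> N"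
    then have "(\<Sum>j = 1..N. (\<kappa> n j)\<^sup>2) \<le> (\<Sum>j = 1..<k. (\<kappa> n j)\<^sup>2)"
      by (intro sum_mono2) auto
    with that N show False by simp
  qed
  then have bdd: "bdd_above ?S" by (intro bdd_aboveI) auto
  have "1 \<in> ?S" using rho_pos[OF assms] by simp
  then show "1 \<le> k_index \<kappa> n" unfolding k_index_def by (rule cSup_upper) fact
  have "Suc (k_index \<kappa> n) \<notin> ?S"
  proof
    assume "Suc (k_index \<kappa> n) \<in> ?S"
    then have "Suc (k_index \<kappa> n) \<le> k_index \<kappa> n"
      unfolding k_index_def by (rule cSup_upper) fact
    then show False by simp
  qed
  then show "rho \<kappa> n / 2 \<le> (\<Sum>j = 1..k_index \<kappa> n. (\<kappa> n j)\<^sup>2)"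
    by (simp add: atLeastLessThanSuc_atLeastAtMost)
qed

text \<open>
  Let \<open>k\<close> be the half-mass index and \<open>v\<close> the weight there. The first \<open>k\<close> weights are comparable to
  \<open>v\<close> and carry half of the mass, so \<open>k * v\<close> is at least of order \<open>n powr (- 2 * r)\<close>; the sum of the
  squared weights gives that \<open>k * v\<^sup>2\<close> is at most of order \<open>1 / n\<^sup>2\<close>. The quotient bounds \<open>v\<close>, and
  with it the largest weight.
\<close>

lemma first_weight_bound:
  obtains B where "0 < B"
    "eventually (\<lambda>n. (\<kappa> n 1)\<^sup>2 \<le> B * real n powr (2 * r - 2)) sequentially"
proof -
  obtain C1 C2 where C: "0 < C1" "0 < C2"
    "\<And>n. 1 \<le> n \<Longrightarrow> C1 * \<sigma> ^ 4 / (real n)\<^sup>2 \<le> (\<Sum>\<^sub>\<infinity>j\<in>{1..}. ((\<kappa> n j)\<^sup>2)\<^sup>2)"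
    "\<And>n. 1 \<le> n \<Longrightarrow> (\<Sum>\<^sub>\<infinity>j\<in>{1..}. ((\<kappa> n j)\<^sup>2)\<^sup>2) \<le> C2 * \<sigma> ^ 4 / (real n)\<^sup>2"
    using squared_weights_bounds by metis
  obtain c1 where c1: "0 < c1" "\<And>n. 1 \<le> n \<Longrightarrow> c1 * real n powr (- 2 * r) \<le> rho \<kappa> n"
    using A3 unfolding A3_def by blast
  have "(\<lambda>n. (\<kappa> n 1)\<^sup>2) \<in> O(\<lambda>n. kappa_sq \<kappa> n)"
    using A5 unfolding A5_def by (simp add: bigthetaD1)
  then obtain a where a: "0 < a"
    "eventually (\<lambda>n. norm ((\<kappa> n 1)\<^sup>2) \<le> a * norm (kappa_sq \<kappa> n)) sequentially"
    by (rule landau_o.bigE)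
  define B where "B = a * (C2 * \<sigma> ^ 4 * (2 * a) / c1)"
  show thesis
  proof (rule that[of B])
    show "0 < B" unfolding B_def using a C c1 \<sigma>_pos by simp
    show "eventually (\<lambda>n. (\<kappa> n 1)\<^sup>2 \<le> B * real n powr (2 * r - 2)) sequentially"
      using a(2) eventually_ge_at_top[of 1]
    proof eventually_elim
      case (elim n)
      define k where "k = k_index \<kappa> n"
      define v where "v = (\<kappa> n k)\<^sup>2"
      define p where "p = real n powr (- 2 * r)"
      have n: "1 \<le> n" using elim by simp
      have p: "0 < p" using n by (simp add: p_def)
      have first: "(\<kappa> n 1)\<^sup>2 \<le> a * v" using elim by (simp add: v_def k_def kappa_sq_def)
      have "c1 * p / 2 \<le> (\<Sum>j = 1..k. (\<kappa> n j)\<^sup>2)"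
        using k_index_half(2)[OF n] c1(2)[OF n] by (simp add: k_def p_def)
      also have "\<dots> \<le> (\<Sum>j = 1..k. a * v)"
        using first weights_antimono[OF n, of 1] by (intro sum_mono) (force intro: order_trans)
      finally have lower: "c1 * p / (2 * a) \<le> real k * v" using a by (simp add: field_simps)
      have "real k * v * v = (\<Sum>j = 1..k. v\<^sup>2)" by (simp add: power2_eq_square)
      also have "\<dots> \<le> (\<Sum>j = 1..k. ((\<kappa> n j)\<^sup>2)\<^sup>2)"
        unfolding v_def using n by (intro sum_mono power_mono weights_antimono) auto
      also have "\<dots> \<le> (\<Sum>\<^sub>\<infinity>j\<in>{1..}. ((\<kappa> n j)\<^sup>2)\<^sup>2)"
        by (intro finite_sum_le_infsum squared_weights_summable n) auto
      also have "\<dots> \<le> C2 * \<sigma> ^ 4 / (real n)\<^sup>2" by (rule C(4)[OF n])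
      finally have upper: "real k * v * v \<le> C2 * \<sigma> ^ 4 / (real n)\<^sup>2" .
      have "c1 * p / (2 * a) * v \<le> real k * v * v"
        using lower by (intro mult_right_mono) (auto simp: v_def)
      with upper have "c1 * p / (2 * a) * v \<le> C2 * \<sigma> ^ 4 / (real n)\<^sup>2" by linarith
      then have "v \<le> C2 * \<sigma> ^ 4 / (real n)\<^sup>2 / (c1 * p / (2 * a))"
        using c1 p a by (subst pos_le_divide_eq) (auto simp: mult.commute)
      also have "\<dots> = C2 * \<sigma> ^ 4 * (2 * a) / c1 * (1 / (p * (real n)\<^sup>2))"
        by simp
      also have "1 / (p * (real n)\<^sup>2) = real n powr (2 * r - 2)"
        using n by (simp add: p_def powr_diff powr_minus divide_simps powr_numeral)
      finally have "a * v \<le> a * (C2 * \<sigma> ^ 4 * (2 * a) / c1 * real n powr (2 * r - 2))"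
        using a by (intro mult_left_mono) auto
      also have "\<dots> = B * real n powr (2 * r - 2)" by (simp only: B_def mult.assoc)
      finally have "a * v \<le> B * real n powr (2 * r - 2)" .
      with first show ?case by linarith
    qed
  qed
qed

end

section \<open>Type II errors as functions of the signal energy\<close>

definition signal_energy ::
  "(nat \<Rightarrow> nat \<Rightarrow> real) \<Rightarrow> (nat \<Rightarrow> real \<Rightarrow> real) \<Rightarrow> nat \<Rightarrow> (real \<Rightarrow> real) \<Rightarrow> real" where
  "signal_energy \<kappa> \<phi> n g = (\<Sum>\<^sub>\<infinity>j\<in>{1..}. (\<kappa> n j)\<^sup>2 * (L2_inner g (\<phi> j))\<^sup>2)"

lemma powr_neg_tendsto_0:
  assumes "a < 0"
  shows "(\<lambda>n. K * real n powr a) \<longlonglongrightarrow> 0"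
  using tendsto_mult_right_zero[OF tendsto_neg_powr[OF assms filterlim_real_sequentially]] by simp

locale detection_problem = gaussian_sequence M \<xi> + quadratic_weights \<kappa> r \<sigma>
  for M :: "'w measure" and \<xi> :: "nat \<Rightarrow> 'w \<Rightarrow> real"
    and \<kappa> :: "nat \<Rightarrow> nat \<Rightarrow> real" and r \<sigma> :: real +
  fixes \<phi> :: "nat \<Rightarrow> real \<Rightarrow> real"
  assumes basis: "orthonormal_basis \<phi>"
begin

abbreviation beta :: "nat \<Rightarrow> real \<Rightarrow> (real \<Rightarrow> real) \<Rightarrow> real" where
  "beta \<equiv> type_II_error M \<xi> \<phi> \<sigma> \<kappa>"

definition noise_form :: "nat \<Rightarrow> 'w \<Rightarrow> real" where
  "noise_form n \<omega> = (\<Sum>\<^sub>\<infinity>j\<in>{1..}. (\<kappa> n j)\<^sup>2 * (\<sigma> / sqrt (real n) * \<xi> j \<omega>)\<^sup>2)"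

lemma noise_form_measurable [measurable]: "noise_form n \<in> borel_measurable M"
  using quadratic_form_measurable[of "\<lambda>j. (\<kappa> n j)\<^sup>2" "\<lambda>_. 0" "\<sigma> / sqrt (real n)"]
  by (simp add: noise_form_def[abs_def])

text \<open>
  The noise variance \<open>\<sigma>\<^sup>2 / n\<close> times \<open>rho\<close> that the statistic subtracts is moved into the threshold.
\<close>

lemma beta_eq:
  "beta n x g = prob {\<omega> \<in> space M. (\<Sum>\<^sub>\<infinity>j\<in>{1..}. (\<kappa> n j)\<^sup>2
      * (L2_inner g (\<phi> j) + \<sigma> / sqrt (real n) * \<xi> j \<omega>)\<^sup>2) \<le> x + \<sigma>\<^sup>2 / real n * rho \<kappa> n}"
  unfolding type_II_error_def rejects_def test_stat_def observation_def
  by (rule arg_cong[where f=prob]) (auto simp: not_less algebra_simps)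

lemma beta_zero_eq:
  "beta n x (\<lambda>_. 0) = prob {\<omega> \<in> space M. noise_form n \<omega> \<le> x + \<sigma>\<^sup>2 / real n * rho \<kappa> n}"
  unfolding beta_eq noise_form_def by (simp add: L2_inner_def)

lemma beta_zero_mono: "x \<le> y \<Longrightarrow> beta n x (\<lambda>_. 0) \<le> beta n y (\<lambda>_. 0)"
  unfolding beta_zero_eq by (rule finite_measure_mono) auto

lemma type_I_error_eq: "type_I_error M \<xi> \<phi> \<sigma> \<kappa> n x = 1 - beta n x (\<lambda>_. 0)"
proof -
  let ?A = "{\<omega> \<in> space M. noise_form n \<omega> \<le> x + \<sigma>\<^sup>2 / real n * rho \<kappa> n}"
  have "{\<omega> \<in> space M. rejects \<kappa> \<sigma> n x (observation \<xi> \<phi> \<sigma> n (\<lambda>_. 0) \<omega>)} = space M - ?A"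
    by (auto simp: rejects_def test_stat_def observation_def noise_form_def L2_inner_def)
  then show ?thesis
    unfolding type_I_error_def beta_zero_eq by (simp add: prob_compl)
qed

lemma asymptotic_level_iff:
  assumes "0 < \<alpha>"
  shows "asymptotic_level M \<xi> \<phi> \<sigma> \<kappa> \<alpha> x \<longleftrightarrow> (\<lambda>n. beta n (x n) (\<lambda>_. 0)) \<longlonglongrightarrow> 1 - \<alpha>"
proof -
  have "asymptotic_level M \<xi> \<phi> \<sigma> \<kappa> \<alpha> x
      \<longleftrightarrow> (\<lambda>n. type_I_error M \<xi> \<phi> \<sigma> \<kappa> n (x n)) \<longlonglongrightarrow> \<alpha>"
    unfolding asymptotic_level_def using assms
    by (auto intro: tendsto_imp_asymp_equiv_const asymp_equivD_const)
  also have "\<dots> \<longleftrightarrow> (\<lambda>n. 1 - beta n (x n) (\<lambda>_. 0)) \<longlonglongrightarrow> \<alpha>"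
    by (simp add: type_I_error_eq)
  also have "\<dots> \<longleftrightarrow> (\<lambda>n. beta n (x n) (\<lambda>_. 0)) \<longlonglongrightarrow> 1 - \<alpha>"
  proof
    assume "(\<lambda>n. 1 - beta n (x n) (\<lambda>_. 0)) \<longlonglongrightarrow> \<alpha>"
    from tendsto_diff[OF tendsto_const[of 1] this]
    show "(\<lambda>n. beta n (x n) (\<lambda>_. 0)) \<longlonglongrightarrow> 1 - \<alpha>" by simp
  next
    assume "(\<lambda>n. beta n (x n) (\<lambda>_. 0)) \<longlonglongrightarrow> 1 - \<alpha>"
    from tendsto_diff[OF tendsto_const[of 1] this]
    show "(\<lambda>n. 1 - beta n (x n) (\<lambda>_. 0)) \<longlonglongrightarrow> \<alpha>" by simp
  qed
  finally show ?thesis .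
qed

text \<open>
  In \<open>anticoncentration_weighted_squares\<close> with window \<open>\<delta> / n\<^sup>2\<close> the first term is proportional to
  \<open>\<delta>\<close>, because the squared weights sum to at least a multiple of \<open>1 / n ^ 4\<close>; the second tends to 0 for fixed
  \<open>\<delta>\<close>, because the ratio of the largest weight to the window is of order \<open>n powr (2 * r - 1)\<close>.
\<close>

lemma noise_form_window:
  assumes "0 < \<epsilon>"
  obtains \<delta> where "0 < \<delta>"
    "eventually (\<lambda>n. \<forall>y. prob {\<omega> \<in> space M. \<bar>noise_form n \<omega> - y\<bar> \<le> \<delta> / (real n)\<^sup>2} \<le> \<epsilon>) sequentially"
proof -
  obtain K :: real where K: "0 < K"
    "\<forall>w b d y. (\<forall>j. 0 \<le> w j) \<and> (\<forall>j\<ge>1. w j \<le> b) \<and> 0 < b \<and> w summable_on {1..} \<and>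
       (\<lambda>j. (w j)\<^sup>2) summable_on {1..} \<and> 0 < (\<Sum>\<^sub>\<infinity>j\<in>{1..}. (w j)\<^sup>2) \<and> 0 < d \<longrightarrow>
       prob {\<omega> \<in> space M. \<bar>(\<Sum>\<^sub>\<infinity>j\<in>{1..}. w j * (\<xi> j \<omega>)\<^sup>2) - y\<bar> \<le> d}
         \<le> 2 * (d / sqrt (\<Sum>\<^sub>\<infinity>j\<in>{1..}. (w j)\<^sup>2) + K * (b / d)\<^sup>2)"
    using anticoncentration_weighted_squares by (elim exE conjE)
  obtain C1 where C1: "0 < C1"
    "\<And>n. 1 \<le> n \<Longrightarrow> C1 * \<sigma> ^ 4 / (real n)\<^sup>2 \<le> (\<Sum>\<^sub>\<infinity>j\<in>{1..}. ((\<kappa> n j)\<^sup>2)\<^sup>2)"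
    using squared_weights_bounds by metis
  obtain B where B: "0 < B"
    "eventually (\<lambda>n. (\<kappa> n 1)\<^sup>2 \<le> B * real n powr (2 * r - 2)) sequentially"
    by (rule first_weight_bound)
  define \<delta> where "\<delta> = \<epsilon> * (\<sigma> ^ 4 * sqrt C1) / 4"
  have \<delta>: "0 < \<delta>" unfolding \<delta>_def using assms \<sigma>_pos C1 by simp
  have "(\<lambda>n. 2 * K * (\<sigma>\<^sup>2 * B / \<delta> * real n powr (2 * r - 1))\<^sup>2) \<longlonglongrightarrow> 2 * K * 0\<^sup>2"
    using r_less by (intro tendsto_mult tendsto_power tendsto_const powr_neg_tendsto_0) auto
  then have small: "eventually (\<lambda>n. 2 * K * (\<sigma>\<^sup>2 * B / \<delta> * real n powr (2 * r - 1))\<^sup>2 < \<epsilon> / 2) sequentially"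
    using assms by (intro order_tendstoD(2)) auto
  show thesis
  proof (rule that[OF \<delta>])
    show "eventually (\<lambda>n. \<forall>y. prob {\<omega> \<in> space M. \<bar>noise_form n \<omega> - y\<bar> \<le> \<delta> / (real n)\<^sup>2} \<le> \<epsilon>) sequentially"
      using small B(2) eventually_ge_at_top[of 1]
    proof eventually_elim
      case (elim n)
      have n: "1 \<le> n" and n0: "0 < real n" using elim by auto
      define w where "w j = \<sigma>\<^sup>2 / real n * (\<kappa> n j)\<^sup>2" for j
      define b where "b = \<sigma>\<^sup>2 / real n * (B * real n powr (2 * r - 2))"
      define d where "d = \<delta> / (real n)\<^sup>2"
      define S where "S = (\<Sum>\<^sub>\<infinity>j\<in>{1..}. (w j)\<^sup>2)"
      have d: "0 < d" using \<delta> n0 by (simp add: d_def)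
      have b: "0 < b" using \<sigma>_pos B n0 by (simp add: b_def)
      have w0: "0 \<le> w j" for j using n0 by (simp add: w_def)
      have wb: "w j \<le> b" if "1 \<le> j" for j
      proof -
        have "(\<kappa> n j)\<^sup>2 \<le> B * real n powr (2 * r - 2)"
          using weights_antimono[OF n order_refl that] elim(2) by linarith
        then show ?thesis unfolding w_def b_def using n0 by (intro mult_left_mono) auto
      qed
      have w2: "(w j)\<^sup>2 = \<sigma> ^ 4 / (real n)\<^sup>2 * ((\<kappa> n j)\<^sup>2)\<^sup>2" for j
        by (simp add: w_def power_mult_distrib power_divide)
      have sw: "w summable_on {1..}"
        unfolding w_def by (intro summable_on_cmult_right weights_summable n)
      have sw2: "(\<lambda>j. (w j)\<^sup>2) summable_on {1..}"
        unfolding w2 by (intro summable_on_cmult_right squared_weights_summable n)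
      have "S = \<sigma> ^ 4 / (real n)\<^sup>2 * (\<Sum>\<^sub>\<infinity>j\<in>{1..}. ((\<kappa> n j)\<^sup>2)\<^sup>2)"
        unfolding S_def w2 by (intro infsum_cmult_right squared_weights_summable n)
      moreover have "\<sigma> ^ 4 / (real n)\<^sup>2 * (C1 * \<sigma> ^ 4 / (real n)\<^sup>2)
          \<le> \<sigma> ^ 4 / (real n)\<^sup>2 * (\<Sum>\<^sub>\<infinity>j\<in>{1..}. ((\<kappa> n j)\<^sup>2)\<^sup>2)"
        using \<sigma>_pos by (intro mult_left_mono C1(2)[OF n]) auto
      moreover have "\<sigma> ^ 4 / (real n)\<^sup>2 * (C1 * \<sigma> ^ 4 / (real n)\<^sup>2)
          = (\<sigma> ^ 4 * sqrt C1 / (real n)\<^sup>2)\<^sup>2"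
        using C1 by (simp add: power_mult_distrib power_divide power2_eq_square)
      ultimately have S: "(\<sigma> ^ 4 * sqrt C1 / (real n)\<^sup>2)\<^sup>2 \<le> S" by simp
      have q: "0 < \<sigma> ^ 4 * sqrt C1 / (real n)\<^sup>2" using \<sigma>_pos C1 n0 by simp
      have S_pos: "0 < S" using S q by (meson less_le_trans zero_less_power)
      have "\<sigma> ^ 4 * sqrt C1 / (real n)\<^sup>2 \<le> sqrt S" by (rule real_le_rsqrt[OF S])
      then have "d / sqrt S \<le> d / (\<sigma> ^ 4 * sqrt C1 / (real n)\<^sup>2)"
        using d q S_pos by (intro divide_left_mono mult_pos_pos) auto
      also have "\<dots> = \<epsilon> / 4"
        using n0 \<sigma>_pos C1 by (simp add: d_def \<delta>_def)
      finally have 1: "d / sqrt S \<le> \<epsilon> / 4" .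
      have "b / d = \<sigma>\<^sup>2 * B / \<delta> * (real n powr (2 * r - 2) * real n)"
        using n0 by (simp add: b_def d_def power2_eq_square)
      also have "real n powr (2 * r - 2) * real n = real n powr (2 * r - 1)"
        using powr_mult_base[of "real n" "2 * r - 2"] by (simp add: mult.commute)
      finally have 2: "K * (b / d)\<^sup>2 \<le> \<epsilon> / 4" using elim(1) by simp
      have nf: "noise_form n \<omega> = (\<Sum>\<^sub>\<infinity>j\<in>{1..}. w j * (\<xi> j \<omega>)\<^sup>2)" for \<omega>
        unfolding noise_form_def
        by (rule infsum_cong) (simp add: w_def power_mult_distrib power_divide)
      show ?case
      proof
        fix y
        have "prob {\<omega> \<in> space M. \<bar>noise_form n \<omega> - y\<bar> \<le> d} \<le> 2 * (d / sqrt S + K * (b / d)\<^sup>2)"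
          unfolding nf S_def
          by (rule K(2)[rule_format])
            (intro conjI allI impI, use w0 wb b sw sw2 S_pos d in \<open>simp_all add: S_def\<close>)
        also have "\<dots> \<le> 2 * (\<epsilon> / 4 + \<epsilon> / 4)" using 1 2 by (intro mult_left_mono add_mono) auto
        also have "\<dots> = \<epsilon>" by simp
        finally show "prob {\<omega> \<in> space M. \<bar>noise_form n \<omega> - y\<bar> \<le> \<delta> / (real n)\<^sup>2} \<le> \<epsilon>"
          by (simp only: d_def)
      qed
    qed
  qed
qed

lemma beta_zero_window:
  assumes "0 < \<epsilon>"
  obtains \<delta> where "0 < \<delta>"
    "eventually (\<lambda>n. \<forall>x y. y \<le> x \<longrightarrow> x \<le> y + \<delta> / (real n)\<^sup>2 \<longrightarrow>
       beta n x (\<lambda>_. 0) \<le> beta n y (\<lambda>_. 0) + \<epsilon>) sequentially"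
proof -
  obtain \<delta> where \<delta>: "0 < \<delta>"
    "eventually (\<lambda>n. \<forall>y. prob {\<omega> \<in> space M. \<bar>noise_form n \<omega> - y\<bar> \<le> \<delta> / (real n)\<^sup>2} \<le> \<epsilon>) sequentially"
    by (rule noise_form_window[OF assms])
  show thesis
  proof (rule that[OF \<delta>(1)])
    show "eventually (\<lambda>n. \<forall>x y. y \<le> x \<longrightarrow> x \<le> y + \<delta> / (real n)\<^sup>2 \<longrightarrow>
       beta n x (\<lambda>_. 0) \<le> beta n y (\<lambda>_. 0) + \<epsilon>) sequentially"
      using \<delta>(2)
    proof eventually_elim
      case (elim n)
      show ?case
      proof (intro allI impI)
        fix x y assume xy: "y \<le> x" "x \<le> y + \<delta> / (real n)\<^sup>2"
        define s where "s = \<sigma>\<^sup>2 / real n * rho \<kappa> n"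
        let ?N = "{\<omega> \<in> space M. \<bar>noise_form n \<omega> - (x + s)\<bar> \<le> \<delta> / (real n)\<^sup>2}"
        let ?Y = "{\<omega> \<in> space M. noise_form n \<omega> \<le> y + s}"
        have "beta n x (\<lambda>_. 0) = prob {\<omega> \<in> space M. noise_form n \<omega> \<le> x + s}"
          by (simp add: beta_zero_eq s_def)
        also have "\<dots> \<le> prob (?Y \<union> ?N)"
          by (rule finite_measure_mono) (use xy in auto)
        also have "\<dots> \<le> prob ?Y + prob ?N" by (rule measure_Un_le) measurable
        also have "prob ?Y = beta n y (\<lambda>_. 0)" by (simp add: beta_zero_eq s_def)
        finally show "beta n x (\<lambda>_. 0) \<le> beta n y (\<lambda>_. 0) + \<epsilon>"
          using elim[rule_format, of "x + s"] by linarith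
      qed
    qed
  qed
qed

text \<open>
  The cross term is negligible: relative to the square of the window \<open>\<delta> / n\<^sup>2\<close> its variance is of order
  \<open>n powr (2 * r - 1)\<close>, which tends to 0 since \<open>r < 1/2\<close>.
\<close>

lemma beta_shift:
  assumes "0 < \<epsilon>" and g: "\<forall>n\<ge>1. g n \<in> L2"
    and norm: "\<forall>n\<ge>1. L2_norm (g n) \<le> C * real n powr (- r)"
  shows "eventually (\<lambda>n. \<forall>x. \<bar>beta n x (g n) - beta n (x - signal_energy \<kappa> \<phi> n (g n)) (\<lambda>_. 0)\<bar> \<le> \<epsilon>)
    sequentially"
proof -
  have half: "0 < \<epsilon> / 2" using assms by simp
  obtain \<delta> where \<delta>: "0 < \<delta>"
    "eventually (\<lambda>n. \<forall>y. prob {\<omega> \<in> space M. \<bar>noise_form n \<omega> - y\<bar> \<le> \<delta> / (real n)\<^sup>2} \<le> \<epsilon> / 2) sequentially"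
    by (rule noise_form_window[OF half])
  obtain B where B: "0 < B"
    "eventually (\<lambda>n. (\<kappa> n 1)\<^sup>2 \<le> B * real n powr (2 * r - 2)) sequentially"
    by (rule first_weight_bound)
  define H where "H = 4 * \<sigma>\<^sup>2 * B\<^sup>2 * C\<^sup>2 / \<delta>\<^sup>2"
  have "(\<lambda>n. H * real n powr (2 * r - 1)) \<longlonglongrightarrow> 0"
    using r_less by (intro powr_neg_tendsto_0) auto
  then have small: "eventually (\<lambda>n. H * real n powr (2 * r - 1) < \<epsilon> / 2) sequentially"
    using assms(1) by (intro order_tendstoD(2)) auto
  show ?thesis
    using small \<delta>(2) B(2) eventually_ge_at_top[of 1]
  proof eventually_elim
    case (elim n)
    have n: "1 \<le> n" and n0: "0 < real n" using elim by auto
    define b where "b = B * real n powr (2 * r - 2)"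
    define d where "d = \<delta> / (real n)\<^sup>2"
    define \<tau> where "\<tau> = \<sigma> / sqrt (real n)"
    define \<theta> where "\<theta> j = L2_inner (g n) (\<phi> j)" for j
    have d: "0 < d" using \<delta> n0 by (simp add: d_def)
    have \<theta>_le: "(\<Sum>\<^sub>\<infinity>j\<in>{1..}. (\<theta> j)\<^sup>2) \<le> C\<^sup>2 * (real n powr (- r))\<^sup>2"
    proof -
      have "(\<Sum>\<^sub>\<infinity>j\<in>{1..}. (\<theta> j)\<^sup>2) \<le> (L2_norm (g n))\<^sup>2"
        unfolding \<theta>_def by (rule bessel_inequality[OF basis g[rule_format, OF n]])
      also have "\<dots> \<le> (C * real n powr (- r))\<^sup>2"
        by (intro power_mono norm[rule_format, OF n] L2_norm_nonneg)
      finally show ?thesis by (simp add: power_mult_distrib)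
    qed
    have main: "\<bar>prob {\<omega> \<in> space M. (\<Sum>\<^sub>\<infinity>j\<in>{1..}. (\<kappa> n j)\<^sup>2 * (\<theta> j + \<tau> * \<xi> j \<omega>)\<^sup>2) \<le> z}
      - prob {\<omega> \<in> space M. (\<Sum>\<^sub>\<infinity>j\<in>{1..}. (\<kappa> n j)\<^sup>2 * (\<tau> * \<xi> j \<omega>)\<^sup>2)
                \<le> z - (\<Sum>\<^sub>\<infinity>j\<in>{1..}. (\<kappa> n j)\<^sup>2 * (\<theta> j)\<^sup>2)}\<bar>
      \<le> 4 * \<tau>\<^sup>2 * b\<^sup>2 * (\<Sum>\<^sub>\<infinity>j\<in>{1..}. (\<theta> j)\<^sup>2) / d\<^sup>2 + \<epsilon> / 2" for z
    proof (rule quadratic_form_shift)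
      show "(\<kappa> n j)\<^sup>2 \<le> b" if "1 \<le> j" for j
        using weights_antimono[OF n order_refl that] elim(3) by (simp add: b_def)
      show "(\<lambda>j. (\<kappa> n j)\<^sup>2) summable_on {1..}" by (rule weights_summable[OF n])
      show "(\<lambda>j. (\<theta> j)\<^sup>2) summable_on {1..}"
        unfolding \<theta>_def by (rule coefficients_square_summable[OF basis g[rule_format, OF n]])
      show "prob {\<omega> \<in> space M. \<bar>(\<Sum>\<^sub>\<infinity>j\<in>{1..}. (\<kappa> n j)\<^sup>2 * (\<tau> * \<xi> j \<omega>)\<^sup>2) - y\<bar> \<le> d} \<le> \<epsilon> / 2" for y
        using elim(2)[rule_format, of y] by (simp only: noise_form_def d_def \<tau>_def)
    qed (use d in auto)
    have "4 * \<tau>\<^sup>2 * b\<^sup>2 * (\<Sum>\<^sub>\<infinity>j\<in>{1..}. (\<theta> j)\<^sup>2) / d\<^sup>2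
        \<le> 4 * \<tau>\<^sup>2 * b\<^sup>2 * (C\<^sup>2 * (real n powr (- r))\<^sup>2) / d\<^sup>2"
      using \<theta>_le by (intro divide_right_mono mult_left_mono) auto
    also have "\<dots> = H * (real n powr (2 * r - 2) * real n powr (2 * r - 2)
        * (real n powr (- r) * real n powr (- r)) * (real n * real n * real n))"
      using n0 \<delta> by (simp add: H_def \<tau>_def b_def d_def power_mult_distrib power_divide
          power2_eq_square field_simps)
    also have "real n * real n * real n = real n powr 3"
      using n0 by (simp add: powr_numeral power3_eq_cube)
    also have "real n powr (2 * r - 2) * real n powr (2 * r - 2)
        * (real n powr (- r) * real n powr (- r)) * real n powr 3 = real n powr (2 * r - 1)"
      unfolding powr_add[symmetric] by (rule arg_cong[where f="(powr) (real n)"]) simp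
    finally have cross: "4 * \<tau>\<^sup>2 * b\<^sup>2 * (\<Sum>\<^sub>\<infinity>j\<in>{1..}. (\<theta> j)\<^sup>2) / d\<^sup>2 \<le> \<epsilon> / 2"
      using elim(1) by linarith
    show ?case
    proof
      fix x
      define z where "z = x + \<sigma>\<^sup>2 / real n * rho \<kappa> n"
      have 1: "beta n x (g n)
          = prob {\<omega> \<in> space M. (\<Sum>\<^sub>\<infinity>j\<in>{1..}. (\<kappa> n j)\<^sup>2 * (\<theta> j + \<tau> * \<xi> j \<omega>)\<^sup>2) \<le> z}"
        by (simp only: beta_eq \<theta>_def \<tau>_def z_def)
      have "beta n (x - signal_energy \<kappa> \<phi> n (g n)) (\<lambda>_. 0)
          = prob {\<omega> \<in> space M. noise_form n \<omega> \<le> z - signal_energy \<kappa> \<phi> n (g n)}"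
        by (simp add: beta_zero_eq z_def algebra_simps)
      then have 2: "beta n (x - signal_energy \<kappa> \<phi> n (g n)) (\<lambda>_. 0)
          = prob {\<omega> \<in> space M. (\<Sum>\<^sub>\<infinity>j\<in>{1..}. (\<kappa> n j)\<^sup>2 * (\<tau> * \<xi> j \<omega>)\<^sup>2)
                \<le> z - (\<Sum>\<^sub>\<infinity>j\<in>{1..}. (\<kappa> n j)\<^sup>2 * (\<theta> j)\<^sup>2)}"
        by (simp only: noise_form_def signal_energy_def \<theta>_def \<tau>_def)
      show "\<bar>beta n x (g n) - beta n (x - signal_energy \<kappa> \<phi> n (g n)) (\<lambda>_. 0)\<bar> \<le> \<epsilon>"
        using main[of z] cross unfolding 1 2 by linarith
    qed
  qed
qed

text \<open>
  The definition of consistency speaks about thresholds of a given asymptotic level, so it has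
  content only once such thresholds are exhibited. A threshold is taken within \<open>1 / (1 + n) ^ 3\<close>
  of the point where the type II error at 0 crosses \<open>1 - \<alpha>\<close>; this step is of smaller order than
  \<open>1 / n\<^sup>2\<close>, so by \<open>beta_zero_window\<close> the error at the threshold itself tends to \<open>1 - \<alpha>\<close>.
\<close>

lemma level_thresholds_exist:
  assumes "0 < \<alpha>" "\<alpha> < 1"
  obtains x where "asymptotic_level M \<xi> \<phi> \<sigma> \<kappa> \<alpha> x"
proof -
  have "\<exists>y. beta n (y - h) (\<lambda>_. 0) < 1 - \<alpha> \<and> 1 - \<alpha> \<le> beta n y (\<lambda>_. 0)"
    if h: "0 < h" for n and h :: real
  proof -
    define s where "s = \<sigma>\<^sup>2 / real n * rho \<kappa> n"
    interpret D: real_distribution "distr M borel (noise_form n)"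
      by (rule real_distribution_distr[OF noise_form_measurable])
    have cdf: "cdf (distr M borel (noise_form n)) y = beta n (y - s) (\<lambda>_. 0)" for y
      by (simp add: cdf_def measure_distr beta_zero_eq s_def vimage_def Int_def conj_commute)
    have "eventually (\<lambda>y. 1 - \<alpha> < cdf (distr M borel (noise_form n)) y) at_top"
      using D.cdf_lim_at_top_prob assms by (intro order_tendstoD(1)) auto
    then obtain u where u: "1 - \<alpha> < beta n u (\<lambda>_. 0)"
      unfolding cdf eventually_at_top_linorder by auto
    have "eventually (\<lambda>y. cdf (distr M borel (noise_form n)) y < 1 - \<alpha>) at_bot"
      using D.cdf_lim_at_bot assms by (intro order_tendstoD(2)) auto
    then obtain l where l: "beta n l (\<lambda>_. 0) < 1 - \<alpha>"
      unfolding cdf eventually_at_bot_linorder by auto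
    define P where "P k \<longleftrightarrow> 1 - \<alpha> \<le> beta n (l + real k * h) (\<lambda>_. 0)" for k
    obtain k where "u - l \<le> real k * h"
      using reals_Archimedean3[OF h] by (meson less_imp_le)
    then have "P k"
      unfolding P_def using u beta_zero_mono[of u "l + real k * h" n] by linarith
    then have least: "P (LEAST k. P k)" by (rule LeastI)
    have "\<not> P 0" using l by (simp add: P_def)
    then obtain m where m: "(LEAST k. P k) = Suc m" using least by (metis not0_implies_Suc)
    then have "\<not> P m" by (metis lessI not_less_Least)
    then have "beta n (l + real (Suc m) * h - h) (\<lambda>_. 0) < 1 - \<alpha>"
      by (simp add: P_def algebra_simps)
    with least m show ?thesis unfolding P_def by metis
  qed
  then have "\<forall>n. \<exists>y. beta n (y - 1 / (1 + real n) ^ 3) (\<lambda>_. 0) < 1 - \<alpha> \<and> 1 - \<alpha> \<le> beta n y (\<lambda>_. 0)"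
    by simp
  then obtain x where x: "\<And>n. beta n (x n - 1 / (1 + real n) ^ 3) (\<lambda>_. 0) < 1 - \<alpha>"
    "\<And>n. 1 - \<alpha> \<le> beta n (x n) (\<lambda>_. 0)" by metis
  have "(\<lambda>n. beta n (x n) (\<lambda>_. 0)) \<longlonglongrightarrow> 1 - \<alpha>"
  proof (rule LIMSEQ_I)
    fix \<epsilon> :: real assume \<epsilon>: "0 < \<epsilon>"
    then have half: "0 < \<epsilon> / 2" by simp
    obtain \<delta> where \<delta>: "0 < \<delta>"
      "eventually (\<lambda>n. \<forall>x y. y \<le> x \<longrightarrow> x \<le> y + \<delta> / (real n)\<^sup>2 \<longrightarrow>
         beta n x (\<lambda>_. 0) \<le> beta n y (\<lambda>_. 0) + \<epsilon> / 2) sequentially"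
      by (rule beta_zero_window[OF half])
    have "eventually (\<lambda>n. norm (beta n (x n) (\<lambda>_. 0) - (1 - \<alpha>)) < \<epsilon>) sequentially"
      using \<delta>(2) eventually_ge_at_top[of "max 1 (nat \<lceil>1 / \<delta>\<rceil>)"]
    proof eventually_elim
      case (elim n)
      have n: "1 \<le> n" "1 / \<delta> \<le> real n" using elim(2) by (auto simp: nat_le_iff ceiling_le_iff)
      have "1 / (1 + real n) ^ 3 \<le> 1 / real n ^ 3"
        using n by (intro divide_left_mono power_mono) auto
      also have "\<dots> = 1 / real n / (real n)\<^sup>2"
        by (simp add: power3_eq_cube power2_eq_square)
      also have "\<dots> \<le> \<delta> / (real n)\<^sup>2"
        using n \<delta>(1) by (intro divide_right_mono) (auto simp: field_simps)
      finally have "x n \<le> (x n - 1 / (1 + real n) ^ 3) + \<delta> / (real n)\<^sup>2" by simp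
      moreover have "x n - 1 / (1 + real n) ^ 3 \<le> x n" by simp
      ultimately have "beta n (x n) (\<lambda>_. 0) \<le> beta n (x n - 1 / (1 + real n) ^ 3) (\<lambda>_. 0) + \<epsilon> / 2"
        using elim(1) by blast
      then show ?case using x[of n] \<epsilon> by (simp add: abs_if)
    qed
    then show "\<exists>N. \<forall>n\<ge>N. norm (beta n (x n) (\<lambda>_. 0) - (1 - \<alpha>)) < \<epsilon>"
      by (simp add: eventually_sequentially)
  qed
  then show thesis using that asymptotic_level_iff[OF assms(1)] by blast
qed

end

section \<open>Approximation by truncation\<close>

context detection_problem
begin

lemma signal_energy_summable:
  assumes "1 \<le> n" "g \<in> L2"
  shows "(\<lambda>j. (\<kappa> n j)\<^sup>2 * (L2_inner g (\<phi> j))\<^sup>2) summable_on {1..}"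
proof (rule summable_on_comparison_test)
  show "(\<lambda>j. (\<kappa> n 1)\<^sup>2 * (L2_inner g (\<phi> j))\<^sup>2) summable_on {1..}"
    by (intro summable_on_cmult_right coefficients_square_summable[OF basis] assms)
  show "(\<kappa> n j)\<^sup>2 * (L2_inner g (\<phi> j))\<^sup>2 \<le> (\<kappa> n 1)\<^sup>2 * (L2_inner g (\<phi> j))\<^sup>2"
    if "j \<in> {1..}" for j
    using that assms by (intro mult_right_mono weights_antimono) auto
qed auto

lemma signal_energy_nonneg: "0 \<le> signal_energy \<kappa> \<phi> n g"
  unfolding signal_energy_def by (rule infsum_nonneg) auto

lemma signal_energy_le:
  assumes "1 \<le> n" "g \<in> L2" "0 \<le> B"
    and "\<And>j. 1 \<le> j \<Longrightarrow> L2_inner g (\<phi> j) \<noteq> 0 \<Longrightarrow> (\<kappa> n j)\<^sup>2 \<le> B"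
  shows "signal_energy \<kappa> \<phi> n g \<le> B * (L2_norm g)\<^sup>2"
proof -
  have "signal_energy \<kappa> \<phi> n g \<le> (\<Sum>\<^sub>\<infinity>j\<in>{1..}. B * (L2_inner g (\<phi> j))\<^sup>2)"
    unfolding signal_energy_def
  proof (rule infsum_mono[OF signal_energy_summable[OF assms(1,2)]])
    show "(\<lambda>j. B * (L2_inner g (\<phi> j))\<^sup>2) summable_on {1..}"
      by (intro summable_on_cmult_right coefficients_square_summable[OF basis] assms)
    show "(\<kappa> n j)\<^sup>2 * (L2_inner g (\<phi> j))\<^sup>2 \<le> B * (L2_inner g (\<phi> j))\<^sup>2" if "j \<in> {1..}" for j
      using assms(4)[of j] that by (cases "L2_inner g (\<phi> j) = 0") (auto intro!: mult_right_mono)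
  qed
  also have "\<dots> = B * (\<Sum>\<^sub>\<infinity>j\<in>{1..}. (L2_inner g (\<phi> j))\<^sup>2)"
    by (intro infsum_cmult_right coefficients_square_summable[OF basis] assms)
  also have "\<dots> \<le> B * (L2_norm g)\<^sup>2"
    by (intro mult_left_mono bessel_inequality[OF basis] assms)
  finally show ?thesis .
qed

lemma residual_coefficient:
  assumes "g \<in> L2" "1 \<le> k"
  shows "L2_inner (\<lambda>t. g t - L2_truncation \<phi> g m t) (\<phi> k) = (if k \<le> m then 0 else L2_inner g (\<phi> k))"
  using assms
  by (simp add: L2_inner_diff_left truncation_L2[OF basis] basis_L2[OF basis]
      truncation_coefficient[OF basis])

text \<open>
  The truncation and the residual have disjoint sets of nonzero coefficients.
\<close>

lemma signal_energy_split:
  assumes "1 \<le> n" "g \<in> L2"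
  shows "signal_energy \<kappa> \<phi> n g = signal_energy \<kappa> \<phi> n (L2_truncation \<phi> g m)
    + signal_energy \<kappa> \<phi> n (\<lambda>t. g t - L2_truncation \<phi> g m t)"
proof -
  note L = truncation_L2[OF basis, of g m]
  have "signal_energy \<kappa> \<phi> n (L2_truncation \<phi> g m)
      + signal_energy \<kappa> \<phi> n (\<lambda>t. g t - L2_truncation \<phi> g m t)
    = (\<Sum>\<^sub>\<infinity>j\<in>{1..}. (\<kappa> n j)\<^sup>2 * (L2_inner (L2_truncation \<phi> g m) (\<phi> j))\<^sup>2
      + (\<kappa> n j)\<^sup>2 * (L2_inner (\<lambda>t. g t - L2_truncation \<phi> g m t) (\<phi> j))\<^sup>2)"
    unfolding signal_energy_def
    by (intro infsum_add[symmetric] signal_energy_summable L L2_diff assms)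
  also have "\<dots> = signal_energy \<kappa> \<phi> n g"
    unfolding signal_energy_def
    by (rule infsum_cong)
      (simp add: residual_coefficient truncation_coefficient[OF basis] assms)
  finally show ?thesis ..
qed

text \<open>
  Where the energy is below \<open>\<delta> / n\<^sup>2\<close>, the type II error is within \<open>2 * \<epsilon>\<close> of the one at 0, which
  tends to \<open>1 - \<alpha>\<close>. Consistency keeps the type II error away from \<open>1 - \<alpha>\<close> eventually, so this
  can happen for finitely many \<open>n\<close> only. The argument is run at the level \<open>\<alpha> = 1/2\<close>.
\<close>

lemma consistent_signal_energy:
  assumes f: "\<And>n. 1 \<le> n \<Longrightarrow> f n \<in> L2"
    and norm: "\<And>n. 1 \<le> n \<Longrightarrow> L2_norm (f n) \<le> C * real n powr (- r)"
    and cons: "consistent M \<xi> \<phi> \<sigma> \<kappa> f"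
  obtains \<delta> where "0 < \<delta>"
    "eventually (\<lambda>n. \<delta> / (real n)\<^sup>2 < signal_energy \<kappa> \<phi> n (f n)) sequentially"
proof -
  obtain x where x: "asymptotic_level M \<xi> \<phi> \<sigma> \<kappa> (1/2) x"
    by (rule level_thresholds_exist[of "1/2"]) auto
  have "limsup (\<lambda>n. ereal (beta n (x n) (f n))) < ereal (1 - 1/2)"
    by (rule cons[unfolded consistent_def, rule_format]) (use x in auto)
  then obtain b where b: "limsup (\<lambda>n. ereal (beta n (x n) (f n))) < ereal b" "b < 1/2"
    using ereal_dense2 by force
  have ev1: "eventually (\<lambda>n. beta n (x n) (f n) < b) sequentially"
    using Limsup_lessD[OF b(1)] by simp
  define \<epsilon> where "\<epsilon> = (1/2 - b) / 4"
  have \<epsilon>: "0 < \<epsilon>" and gap: "4 * \<epsilon> = 1/2 - b" using b by (simp_all add: \<epsilon>_def)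
  have "(\<lambda>n. beta n (x n) (\<lambda>_. 0)) \<longlonglongrightarrow> 1 - 1/2" using x asymptotic_level_iff[of "1/2" x] by simp
  then have ev2: "eventually (\<lambda>n. 1/2 - \<epsilon> < beta n (x n) (\<lambda>_. 0)) sequentially"
    using \<epsilon> by (intro order_tendstoD(1)) auto
  obtain \<delta> where \<delta>: "0 < \<delta>"
    "eventually (\<lambda>n. \<forall>x y. y \<le> x \<longrightarrow> x \<le> y + \<delta> / (real n)\<^sup>2 \<longrightarrow>
       beta n x (\<lambda>_. 0) \<le> beta n y (\<lambda>_. 0) + \<epsilon>) sequentially"
    by (rule beta_zero_window[OF \<epsilon>])
  have ev3: "eventually (\<lambda>n. \<forall>x. \<bar>beta n x (f n) - beta n (x - signal_energy \<kappa> \<phi> n (f n)) (\<lambda>_. 0)\<bar>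
      \<le> \<epsilon>) sequentially"
    by (rule beta_shift[OF \<epsilon>]) (use f norm in auto)
  show thesis
  proof (rule that[OF \<delta>(1)])
    show "eventually (\<lambda>n. \<delta> / (real n)\<^sup>2 < signal_energy \<kappa> \<phi> n (f n)) sequentially"
      using ev1 ev2 ev3 \<delta>(2)
    proof eventually_elim
      case (elim n)
      let ?E = "signal_energy \<kappa> \<phi> n (f n)"
      show ?case
      proof (rule ccontr)
        assume "\<not> \<delta> / (real n)\<^sup>2 < ?E"
        then have "beta n (x n) (\<lambda>_. 0) \<le> beta n (x n - ?E) (\<lambda>_. 0) + \<epsilon>"
          using signal_energy_nonneg[of n "f n"] by (intro elim(4)[rule_format]) auto
        moreover have "beta n (x n - ?E) (\<lambda>_. 0) \<le> beta n (x n) (f n) + \<epsilon>"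
          using elim(3)[rule_format, of "x n"] by (simp add: abs_le_iff)
        ultimately have "1/2 - 3 * \<epsilon> < b" using elim(1,2) by linarith
        then show False using \<epsilon> gap by linarith
      qed
    qed
  qed
qed

text \<open>
  The cutoff has the order \<open>n powr (2 - 4 * r)\<close> that makes the body norm bounded. For the finitely
  many \<open>n < N\<close>, for which no energy bound will be available, it is raised until the truncation
  keeps half of the norm; this costs only a larger radius \<open>P0\<close>.
\<close>

lemma truncation_cutoffs_exist:
  assumes s: "s = r / (2 - 4 * r)" and "0 < L"
    and f: "\<And>n. 1 \<le> n \<Longrightarrow> f n \<in> L2"
    and norm: "\<And>n. 1 \<le> n \<Longrightarrow> L2_norm (f n) \<le> C * real n powr (- r)"
    and pos: "\<And>n. 1 \<le> n \<Longrightarrow> 0 < L2_norm (f n)"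
  shows "\<exists>P0>0. \<exists>m. \<forall>n\<ge>1. 1 \<le> m n \<and> L * real n powr (2 - 4 * r) \<le> real (m n) \<and>
    L2_truncation \<phi> (f n) (m n) \<in> besov_body \<phi> s P0 \<and>
    (n < N \<longrightarrow> L2_norm (f n) / 2 \<le> L2_norm (L2_truncation \<phi> (f n) (m n)))"
proof -
  have "\<exists>k. \<forall>j\<ge>k. L2_norm (f n) / 2 \<le> L2_norm (L2_truncation \<phi> (f n) j)" if n: "1 \<le> n" for n
  proof -
    have "eventually (\<lambda>j. L2_norm (f n) / 2 < L2_norm (L2_truncation \<phi> (f n) j)) sequentially"
      using truncation_norm_tendsto[OF basis f[OF n]] pos[OF n] by (intro order_tendstoD(1)) auto
    then show ?thesis unfolding eventually_sequentially by (meson less_imp_le)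
  qed
  then obtain k where k: "\<And>n j. 1 \<le> n \<Longrightarrow> k n \<le> j \<Longrightarrow>
      L2_norm (f n) / 2 \<le> L2_norm (L2_truncation \<phi> (f n) j)" by metis
  define a where "a n = nat \<lceil>L * real n powr (2 - 4 * r)\<rceil>" for n
  define m where "m n = (if n < N then max (a n) (k n) else a n)" for n
  define P where "P n = real (m n) powr (2 * s) * (L2_norm (f n))\<^sup>2" for n
  define P0 where "P0 = ((L + 1) powr (2 * s) * C\<^sup>2 + 1) + (\<Sum>n<N. P n)"
  have P_nonneg: "0 \<le> P n" for n by (simp add: P_def)
  have s_pos: "0 < s" using s r_pos r_less by simp
  have "2 - 4 * r \<noteq> 0" using r_less by simp
  then have exponent: "(2 - 4 * r) * (2 * s) = 2 * r" by (simp add: s)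
  have a_ge: "L * real n powr (2 - 4 * r) \<le> real (a n)" for n
    unfolding a_def by (rule real_nat_ceiling_ge)
  have a_pos: "1 \<le> a n" if "1 \<le> n" for n
  proof -
    have "0 < L * real n powr (2 - 4 * r)" using that \<open>0 < L\<close> by simp
    then have "0 < real (a n)" using a_ge[of n] by linarith
    then show ?thesis by simp
  qed
  have m_ge: "a n \<le> m n" for n by (simp add: m_def)
  have tail: "P n \<le> (L + 1) powr (2 * s) * C\<^sup>2" if n: "1 \<le> n" "\<not> n < N" for n
  proof -
    have n1: "1 \<le> real n" using n by simp
    then have one: "1 \<le> real n powr (2 - 4 * r)" using r_less by (intro ge_one_powr_ge_zero) auto
    have "real (a n) \<le> L * real n powr (2 - 4 * r) + 1"
      unfolding a_def using \<open>0 < L\<close> by simp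
    also have "\<dots> \<le> (L + 1) * real n powr (2 - 4 * r)" using one by (simp add: algebra_simps)
    finally have "real (m n) \<le> (L + 1) * real n powr (2 - 4 * r)" using n by (simp add: m_def)
    then have "real (m n) powr (2 * s) \<le> ((L + 1) * real n powr (2 - 4 * r)) powr (2 * s)"
      using s_pos by (intro powr_mono2) auto
    also have "\<dots> = (L + 1) powr (2 * s) * real n powr (2 * r)"
      using \<open>0 < L\<close> by (simp add: powr_mult powr_powr exponent)
    finally have "P n \<le> ((L + 1) powr (2 * s) * real n powr (2 * r)) * (C * real n powr (- r))\<^sup>2"
      unfolding P_def by (intro mult_mono power_mono norm n(1) L2_norm_nonneg) auto
    also have "\<dots> = (L + 1) powr (2 * s) * C\<^sup>2 * (real n powr (2 * r) * (real n powr (- r) * real n powr (- r)))"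
      by (simp add: power2_eq_square mult_ac)
    also have "real n powr (2 * r) * (real n powr (- r) * real n powr (- r)) = 1"
      using n1 unfolding powr_add[symmetric] by simp
    finally show ?thesis by simp
  qed
  have P_le: "P n \<le> P0" if n: "1 \<le> n" for n
  proof (cases "n < N")
    case True
    then have "P n \<le> (\<Sum>n<N. P n)" using P_nonneg by (intro member_le_sum) auto
    then show ?thesis unfolding P0_def by (smt (verit) powr_ge_zero mult_nonneg_nonneg zero_le_power2)
  next
    case False
    have "0 \<le> (\<Sum>n<N. P n)" using P_nonneg by (intro sum_nonneg)
    then show ?thesis using tail[OF n False] unfolding P0_def by linarith
  qed
  show ?thesis
  proof (intro exI[of _ P0] exI[of _ m] conjI allI impI)
    have "0 \<le> (\<Sum>n<N. P n)" using P_nonneg by (intro sum_nonneg)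
    moreover have "0 \<le> (L + 1) powr (2 * s) * C\<^sup>2" by simp
    ultimately show "0 < P0" unfolding P0_def by linarith
    fix n :: nat assume n: "1 \<le> n"
    show "1 \<le> m n" using a_pos[OF n] m_ge[of n] by linarith
    show "L * real n powr (2 - 4 * r) \<le> real (m n)"
      using a_ge[of n] m_ge[of n] by linarith
    show "L2_truncation \<phi> (f n) (m n) \<in> besov_body \<phi> s P0"
      using P_le[OF n] s_pos unfolding P_def
      by (intro truncation_in_besov_body[OF basis f[OF n]]) auto
    show "L2_norm (f n) / 2 \<le> L2_norm (L2_truncation \<phi> (f n) (m n))" if "n < N"
      using that by (intro k[OF n]) (simp add: m_def)
  qed
qed

text \<open>
  The energy is at most the largest weight times the squared norm.
\<close>

lemma truncation_energy_norm:
  assumes "1 \<le> n" "g \<in> L2" "(\<kappa> n 1)\<^sup>2 \<le> B * real n powr (2 * r - 2)" "0 < B"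
    and "\<delta> / (real n)\<^sup>2 \<le> signal_energy \<kappa> \<phi> n (L2_truncation \<phi> g m)"
  shows "sqrt (\<delta> / B) * real n powr (- r) \<le> L2_norm (L2_truncation \<phi> g m)"
proof -
  let ?p = "L2_truncation \<phi> g m"
  have n0: "0 < real n" using assms by simp
  have "\<delta> / (real n)\<^sup>2 \<le> (\<kappa> n 1)\<^sup>2 * (L2_norm ?p)\<^sup>2"
    by (rule order_trans[OF assms(5)], rule signal_energy_le)
      (use assms truncation_L2[OF basis] weights_antimono[of n 1] in auto)
  also have "\<dots> \<le> B * real n powr (2 * r - 2) * (L2_norm ?p)\<^sup>2"
    using assms by (intro mult_right_mono) auto
  also have "real n powr (2 * r - 2) = real n powr (2 * r) / (real n)\<^sup>2"
    using n0 by (simp add: powr_diff powr_numeral)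
  finally have "\<delta> \<le> B * real n powr (2 * r) * (L2_norm ?p)\<^sup>2"
    using n0 by (simp add: field_simps)
  then have "\<delta> / B * real n powr (- (2 * r)) \<le> (L2_norm ?p)\<^sup>2"
    using n0 assms(4) by (simp add: powr_minus field_simps)
  then have "sqrt (\<delta> / B * real n powr (- (2 * r))) \<le> L2_norm ?p"
    by (intro real_le_lsqrt L2_norm_nonneg)
  moreover have "real n powr (- (2 * r)) = (real n powr (- r))\<^sup>2"
    by (simp add: power2_eq_square powr_add[symmetric])
  ultimately show ?thesis
    by (simp only: real_sqrt_mult real_sqrt_abs abs_of_nonneg[OF powr_ge_zero])
qed

lemma truncation_approximates:
  assumes "0 < \<epsilon>" and s: "s = r / (2 - 4 * r)" and "0 < c" "c < C"
    and f: "\<And>n. 1 \<le> n \<Longrightarrow> f n \<in> L2"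
    and norm_lower: "\<And>n. 1 \<le> n \<Longrightarrow> c * real n powr (- r) \<le> L2_norm (f n)"
    and norm: "\<And>n. 1 \<le> n \<Longrightarrow> L2_norm (f n) \<le> C * real n powr (- r)"
    and cons: "consistent M \<xi> \<phi> \<sigma> \<kappa> f"
  shows "\<exists>P0 c1 C1 f1. 0 < P0 \<and> 0 < c1 \<and> c1 < C1 \<and>
    (\<forall>n\<ge>1. f1 n \<in> besov_body \<phi> s P0 \<and>
       c1 * real n powr (- r) \<le> L2_norm (f1 n) \<and> L2_norm (f1 n) \<le> C1 * real n powr (- r)) \<and>
    (\<forall>n\<ge>1. L2_inner (f1 n) (\<lambda>t. f n t - f1 n t) = 0) \<and>
    (\<forall>\<alpha> x. 0 < \<alpha> \<and> \<alpha> < 1 \<and> asymptotic_level M \<xi> \<phi> \<sigma> \<kappa> \<alpha> x \<longrightarrow>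
       (\<exists>n\<epsilon>\<ge>1. \<forall>n>n\<epsilon>.
          \<bar>beta n (x n) (f n) - beta n (x n) (f1 n)\<bar> \<le> \<epsilon> \<and>
          beta n (x n) (\<lambda>t. f n t - f1 n t) \<ge> 1 - \<alpha> - \<epsilon>))"
proof -
  have quarter: "0 < \<epsilon> / 4" using assms by simp
  obtain \<delta>0 where \<delta>0: "0 < \<delta>0"
    "eventually (\<lambda>n. \<delta>0 / (real n)\<^sup>2 < signal_energy \<kappa> \<phi> n (f n)) sequentially"
    by (rule consistent_signal_energy[OF f norm cons])
  obtain \<delta>1 where \<delta>1: "0 < \<delta>1"
    "eventually (\<lambda>n. \<forall>x y. y \<le> x \<longrightarrow> x \<le> y + \<delta>1 / (real n)\<^sup>2 \<longrightarrow>
       beta n x (\<lambda>_. 0) \<le> beta n y (\<lambda>_. 0) + \<epsilon> / 4) sequentially"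
    by (rule beta_zero_window[OF quarter])
  obtain B where B: "0 < B"
    "eventually (\<lambda>n. (\<kappa> n 1)\<^sup>2 \<le> B * real n powr (2 * r - 2)) sequentially"
    by (rule first_weight_bound)
  obtain c2 where c2: "0 < c2" "\<And>n. 1 \<le> n \<Longrightarrow> rho \<kappa> n \<le> c2 * real n powr (- 2 * r)"
    using A3 unfolding A3_def by blast
  \<comment> \<open>the residual may cost at most half of the energy of \<open>f n\<close>, and no more than the window allows\<close>
  define \<delta> where "\<delta> = min \<delta>1 (\<delta>0 / 2)"
  have \<delta>: "0 < \<delta>" "\<delta> \<le> \<delta>1" "\<delta> \<le> \<delta>0 / 2" using \<delta>0 \<delta>1 by (auto simp: \<delta>_def)
  \<comment> \<open>with this constant the bound on the residual energy comes out as \<open>\<delta> / n\<^sup>2\<close>\<close>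
  define L where "L = c2 * C\<^sup>2 / \<delta>"
  have C: "0 < C" using assms by simp
  have L: "0 < L" using c2 C \<delta> by (simp add: L_def)
  have pos: "0 < L2_norm (f n)" if "1 \<le> n" for n
  proof -
    have "0 < c * real n powr (- r)" using that \<open>0 < c\<close> by simp
    then show ?thesis using norm_lower[OF that] by linarith
  qed
  obtain n0 where n0: "\<And>n. n0 \<le> n \<Longrightarrow> \<delta>0 / (real n)\<^sup>2 < signal_energy \<kappa> \<phi> n (f n)"
    "\<And>n. n0 \<le> n \<Longrightarrow> (\<kappa> n 1)\<^sup>2 \<le> B * real n powr (2 * r - 2)"
    using eventually_conj[OF \<delta>0(2) B(2)] unfolding eventually_sequentially by blast
  have "\<exists>P0>0. \<exists>m. \<forall>n\<ge>1. 1 \<le> m n \<and> L * real n powr (2 - 4 * r) \<le> real (m n) \<and>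
    L2_truncation \<phi> (f n) (m n) \<in> besov_body \<phi> s P0 \<and>
    (n < n0 \<longrightarrow> L2_norm (f n) / 2 \<le> L2_norm (L2_truncation \<phi> (f n) (m n)))"
    by (rule truncation_cutoffs_exist[OF s L]) (fact f norm pos)+
  then obtain m P0 where P0: "0 < P0" and
    m: "\<And>n. 1 \<le> n \<Longrightarrow> 1 \<le> m n \<and> L * real n powr (2 - 4 * r) \<le> real (m n)" and
    besov: "\<And>n. 1 \<le> n \<Longrightarrow> L2_truncation \<phi> (f n) (m n) \<in> besov_body \<phi> s P0" and
    half: "\<And>n. 1 \<le> n \<Longrightarrow> n < n0 \<Longrightarrow> L2_norm (f n) / 2 \<le> L2_norm (L2_truncation \<phi> (f n) (m n))"
    by blast
  define f1 where "f1 n = L2_truncation \<phi> (f n) (m n)" for n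
  define f2 where "f2 n = (\<lambda>t. f n t - f1 n t)" for n
  have f1: "f1 n \<in> L2" for n unfolding f1_def by (rule truncation_L2[OF basis])
  have f2: "f2 n \<in> L2" if "1 \<le> n" for n unfolding f2_def by (intro L2_diff f f1 that)
  have norm1: "L2_norm (f1 n) \<le> C * real n powr (- r)" if "1 \<le> n" for n
    unfolding f1_def using truncation_norm_le[OF basis f[OF that]] norm[OF that] by (rule order_trans)
  have norm2: "L2_norm (f2 n) \<le> C * real n powr (- r)" if "1 \<le> n" for n
    unfolding f2_def f1_def using residual_norm_le[OF basis f[OF that]] norm[OF that]
    by (rule order_trans)
  have split: "signal_energy \<kappa> \<phi> n (f n) = signal_energy \<kappa> \<phi> n (f1 n) + signal_energy \<kappa> \<phi> n (f2 n)"
    if "1 \<le> n" for n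
    unfolding f2_def f1_def by (rule signal_energy_split[OF that f[OF that]])
  have residual: "signal_energy \<kappa> \<phi> n (f2 n) \<le> \<delta> / (real n)\<^sup>2" if n: "1 \<le> n" for n
  proof -
    have n': "0 < real n" using n by simp
    have m1: "1 \<le> m n" using m[OF n] by simp
    have "L * real n powr (2 - 4 * r) * (\<kappa> n (m n))\<^sup>2 \<le> real (m n) * (\<kappa> n (m n))\<^sup>2"
      using m[OF n] by (intro mult_right_mono) auto
    also have "\<dots> \<le> rho \<kappa> n" by (rule weight_le_rho_div[OF n m1])
    also have "\<dots> \<le> c2 * real n powr (- 2 * r)" by (rule c2(2)[OF n])
    finally have "(\<kappa> n (m n))\<^sup>2 \<le> c2 * real n powr (- 2 * r) / (L * real n powr (2 - 4 * r))"
      using L n' by (subst pos_le_divide_eq) (auto simp: mult.commute)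
    also have "\<dots> = \<delta> / C\<^sup>2 * (real n powr (- 2 * r) / real n powr (2 - 4 * r))"
      using c2 C \<delta> by (simp add: L_def)
    also have "real n powr (- 2 * r) / real n powr (2 - 4 * r) = real n powr (2 * r - 2)"
      by (simp add: powr_diff[symmetric])
    finally have w: "(\<kappa> n (m n))\<^sup>2 \<le> \<delta> / C\<^sup>2 * real n powr (2 * r - 2)" .
    have "signal_energy \<kappa> \<phi> n (f2 n) \<le> (\<kappa> n (m n))\<^sup>2 * (L2_norm (f2 n))\<^sup>2"
    proof (rule signal_energy_le[OF n f2[OF n]])
      fix j :: nat assume j: "1 \<le> j" "L2_inner (f2 n) (\<phi> j) \<noteq> 0"
      then have "m n \<le> j"
        using residual_coefficient[OF f[OF n] j(1), of "m n"]
        by (auto simp: f2_def f1_def split: if_splits)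
      then show "(\<kappa> n j)\<^sup>2 \<le> (\<kappa> n (m n))\<^sup>2" by (rule weights_antimono[OF n m1])
    qed simp
    also have "\<dots> \<le> (\<delta> / C\<^sup>2 * real n powr (2 * r - 2)) * (C * real n powr (- r))\<^sup>2"
      using \<delta> by (intro mult_mono w power_mono norm2 n L2_norm_nonneg) auto
    also have "\<dots> = \<delta> * (real n powr (2 * r - 2) * (real n powr (- r) * real n powr (- r)))"
      using C by (simp add: power2_eq_square)
    also have "real n powr (2 * r - 2) * (real n powr (- r) * real n powr (- r)) = real n powr (- 2)"
      unfolding powr_add[symmetric] by (rule arg_cong[where f="(powr) (real n)"]) simp
    also have "\<delta> * real n powr (- 2) = \<delta> / (real n)\<^sup>2"
      using n' by (simp add: powr_minus powr_numeral divide_inverse)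
    finally show ?thesis .
  qed
  have shift: "eventually (\<lambda>n. \<forall>x. \<bar>beta n x (g n)
      - beta n (x - signal_energy \<kappa> \<phi> n (g n)) (\<lambda>_. 0)\<bar> \<le> \<epsilon> / 4) sequentially"
    if "\<forall>n\<ge>1. g n \<in> L2 \<and> L2_norm (g n) \<le> C * real n powr (- r)" for g
    by (rule beta_shift[OF quarter]) (use that in auto)
  define c1 where "c1 = min (sqrt (\<delta>0 / 2 / B)) (c / 2)"
  have c1: "0 < c1" "c1 < C" using \<delta>0 B assms by (auto simp: c1_def)
  have norm1_lower: "c1 * real n powr (- r) \<le> L2_norm (f1 n)" if n: "1 \<le> n" for n
  proof (cases "n < n0")
    case True
    have "c1 * real n powr (- r) \<le> c / 2 * real n powr (- r)"
      by (intro mult_right_mono) (auto simp: c1_def)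
    also have "\<dots> \<le> L2_norm (f n) / 2" using norm_lower[OF n] by simp
    also have "\<dots> \<le> L2_norm (f1 n)" unfolding f1_def by (rule half[OF n True])
    finally show ?thesis .
  next
    case False
    have "\<delta>0 / (real n)\<^sup>2 - \<delta>0 / 2 / (real n)\<^sup>2 \<le> signal_energy \<kappa> \<phi> n (f n) - \<delta> / (real n)\<^sup>2"
      using n0(1)[of n] False \<delta>(3) by (intro diff_mono divide_right_mono) auto
    also have "\<dots> \<le> signal_energy \<kappa> \<phi> n (f1 n)" using split[OF n] residual[OF n] by linarith
    finally have "\<delta>0 / 2 / (real n)\<^sup>2 \<le> signal_energy \<kappa> \<phi> n (f1 n)" by (simp add: field_simps)
    then have "sqrt (\<delta>0 / 2 / B) * real n powr (- r) \<le> L2_norm (f1 n)"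
      unfolding f1_def using n0(2)[of n] False B n by (intro truncation_energy_norm f) auto
    moreover have "c1 * real n powr (- r) \<le> sqrt (\<delta>0 / 2 / B) * real n powr (- r)"
      by (intro mult_right_mono) (auto simp: c1_def)
    ultimately show ?thesis by linarith
  qed
  have errors: "\<exists>n\<epsilon>\<ge>1. \<forall>n>n\<epsilon>. \<bar>beta n (x n) (f n) - beta n (x n) (f1 n)\<bar> \<le> \<epsilon> \<and>
      beta n (x n) (f2 n) \<ge> 1 - \<alpha> - \<epsilon>"
    if \<alpha>: "0 < \<alpha>" "asymptotic_level M \<xi> \<phi> \<sigma> \<kappa> \<alpha> x" for \<alpha> x
  proof -
    have "(\<lambda>n. beta n (x n) (\<lambda>_. 0)) \<longlonglongrightarrow> 1 - \<alpha>" using \<alpha> asymptotic_level_iff by blast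
    then have level: "eventually (\<lambda>n. 1 - \<alpha> - \<epsilon> / 4 < beta n (x n) (\<lambda>_. 0)) sequentially"
      using quarter by (intro order_tendstoD(1)) auto
    have shift_f: "eventually (\<lambda>n. \<forall>x. \<bar>beta n x (f n)
        - beta n (x - signal_energy \<kappa> \<phi> n (f n)) (\<lambda>_. 0)\<bar> \<le> \<epsilon> / 4) sequentially"
      by (rule shift) (use f norm in blast)
    have shift_f1: "eventually (\<lambda>n. \<forall>x. \<bar>beta n x (f1 n)
        - beta n (x - signal_energy \<kappa> \<phi> n (f1 n)) (\<lambda>_. 0)\<bar> \<le> \<epsilon> / 4) sequentially"
      by (rule shift) (use f1 norm1 in blast)
    have shift_f2: "eventually (\<lambda>n. \<forall>x. \<bar>beta n x (f2 n)
        - beta n (x - signal_energy \<kappa> \<phi> n (f2 n)) (\<lambda>_. 0)\<bar> \<le> \<epsilon> / 4) sequentially"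
      by (rule shift) (use f2 norm2 in blast)
    have "eventually (\<lambda>n. \<bar>beta n (x n) (f n) - beta n (x n) (f1 n)\<bar> \<le> \<epsilon> \<and>
        beta n (x n) (f2 n) \<ge> 1 - \<alpha> - \<epsilon>) sequentially"
      using level \<delta>1(2) shift_f shift_f1 shift_f2 eventually_ge_at_top[of 1]
    proof eventually_elim
      case (elim n)
      have n: "1 \<le> n" using elim by simp
      define E where "E = signal_energy \<kappa> \<phi> n (f n)"
      define E1 where "E1 = signal_energy \<kappa> \<phi> n (f1 n)"
      define E2 where "E2 = signal_energy \<kappa> \<phi> n (f2 n)"
      have E: "E = E1 + E2" unfolding E_def E1_def E2_def by (rule split[OF n])
      have E2: "0 \<le> E2" "E2 \<le> \<delta>1 / (real n)\<^sup>2"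
        using residual[OF n] \<delta>(2) signal_energy_nonneg[of n "f2 n"]
          divide_right_mono[OF \<delta>(2), of "(real n)\<^sup>2"] by (auto simp: E2_def)
      have "beta n (x n - E1) (\<lambda>_. 0) \<le> beta n (x n - E) (\<lambda>_. 0) + \<epsilon> / 4"
        using E E2 by (intro elim(2)[rule_format]) auto
      moreover have "beta n (x n - E) (\<lambda>_. 0) \<le> beta n (x n - E1) (\<lambda>_. 0)"
        using E E2 by (intro beta_zero_mono) auto
      moreover have "beta n (x n) (\<lambda>_. 0) \<le> beta n (x n - E2) (\<lambda>_. 0) + \<epsilon> / 4"
        using E2 by (intro elim(2)[rule_format]) auto
      moreover note elim(1) elim(3)[rule_format, of "x n"] elim(4)[rule_format, of "x n"]
        elim(5)[rule_format, of "x n"]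
      ultimately show ?case
        unfolding E_def[symmetric] E1_def[symmetric] E2_def[symmetric] abs_le_iff
        using quarter by (intro conjI) linarith+
    qed
    then obtain N where "\<forall>n\<ge>N. \<bar>beta n (x n) (f n) - beta n (x n) (f1 n)\<bar> \<le> \<epsilon> \<and>
        beta n (x n) (f2 n) \<ge> 1 - \<alpha> - \<epsilon>"
      unfolding eventually_sequentially by blast
    then show ?thesis by (intro exI[of _ "max 1 N"]) auto
  qed
  show ?thesis
  proof (rule exI[of _ P0], rule exI[of _ c1], rule exI[of _ C], rule exI[of _ f1],
      intro conjI allI impI)
    fix n :: nat assume n: "1 \<le> n"
    show "f1 n \<in> besov_body \<phi> s P0" unfolding f1_def by (rule besov[OF n])
    show "c1 * real n powr (- r) \<le> L2_norm (f1 n)" by (rule norm1_lower[OF n])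
    show "L2_norm (f1 n) \<le> C * real n powr (- r)" by (rule norm1[OF n])
    show "L2_inner (f1 n) (\<lambda>t. f n t - f1 n t) = 0"
      unfolding f1_def by (rule truncation_orthogonal[OF basis f[OF n]])
  next
    fix \<alpha> x assume "0 < \<alpha> \<and> \<alpha> < 1 \<and> asymptotic_level M \<xi> \<phi> \<sigma> \<kappa> \<alpha> x"
    then show "\<exists>n\<epsilon>\<ge>1. \<forall>n>n\<epsilon>. \<bar>beta n (x n) (f n) - beta n (x n) (f1 n)\<bar> \<le> \<epsilon> \<and>
        beta n (x n) (\<lambda>t. f n t - f1 n t) \<ge> 1 - \<alpha> - \<epsilon>"
      using errors[of \<alpha> x] unfolding f2_def by blast
  qed (use P0 c1 in auto)
qed

end

theorem theorem4p6:
  fixes M :: "'w measure" and \<xi> :: "nat \<Rightarrow> 'w \<Rightarrow> real"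
    and \<phi> :: "nat \<Rightarrow> real \<Rightarrow> real" and \<kappa> :: "nat \<Rightarrow> nat \<Rightarrow> real"
    and r \<sigma> s \<epsilon> c C :: real and f :: "nat \<Rightarrow> real \<Rightarrow> real"
  assumes "0 < r" "r < 1/2" "0 < \<sigma>"
    and "s = r / (2 - 4 * r)"
    and "iid_std_gaussian M \<xi>"
    and "orthonormal_basis \<phi>"
    and "A1 \<kappa>" "A2 \<sigma> \<kappa>" "A3 r \<kappa>" "A4 \<kappa>" "A5 \<kappa>"
    and "0 < \<epsilon>"
    and "\<forall>n\<ge>1. f n \<in> L2"
    and "consistent M \<xi> \<phi> \<sigma> \<kappa> f"
    and "0 < c" "c < C"
    and "\<forall>n\<ge>1. c * real n powr (- r) \<le> L2_norm (f n) \<and> L2_norm (f n) \<le> C * real n powr (- r)"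
  shows "\<exists>P0 c1 C1 f1. 0 < P0 \<and> 0 < c1 \<and> c1 < C1 \<and>
    (\<forall>n\<ge>1. f1 n \<in> besov_body \<phi> s P0 \<and>
       c1 * real n powr (- r) \<le> L2_norm (f1 n) \<and> L2_norm (f1 n) \<le> C1 * real n powr (- r)) \<and>
    (\<forall>n\<ge>1. L2_inner (f1 n) (\<lambda>t. f n t - f1 n t) = 0) \<and>
    (\<forall>\<alpha> x. 0 < \<alpha> \<and> \<alpha> < 1 \<and> asymptotic_level M \<xi> \<phi> \<sigma> \<kappa> \<alpha> x \<longrightarrow>
       (\<exists>n\<epsilon>\<ge>1. \<forall>n>n\<epsilon>.
          \<bar>type_II_error M \<xi> \<phi> \<sigma> \<kappa> n (x n) (f n) - type_II_error M \<xi> \<phi> \<sigma> \<kappa> n (x n) (f1 n)\<bar> \<le> \<epsilon> \<and>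
          type_II_error M \<xi> \<phi> \<sigma> \<kappa> n (x n) (\<lambda>t. f n t - f1 n t) \<ge> 1 - \<alpha> - \<epsilon>))"
proof -
  interpret prob_space M using assms(5) by (simp add: iid_std_gaussian_def)
  interpret detection_problem M \<xi> \<kappa> r \<sigma> \<phi>
    by unfold_locales (use assms in \<open>auto simp: iid_std_gaussian_def\<close>)
  show ?thesis
    by (rule truncation_approximates[where c=c and C=C]) (use assms in auto)
qed

end
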